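(* Let $F=\langle g_0,g_1,g_2,\ldots \mid g_n g_k = g_k g_{n+1},\ 0\le k<n<\infty\rangle$ be the Thompson group, let $\mathbb{C}(F)$ be its group $*$-algebra, and let $\varphi:\mathbb{C}(F)\to\mathbb{C}$ be the linear functional determined on group elements by $\varphi(e)=1$ and $\varphi(x)=0$ for $x\in F\setminus\{e\}$. Let $a_n=\frac{g_n+g_n^*}{\sqrt2}$ for $n\in\mathbb{N}_0$ and $s_n=\frac{1}{\sqrt n}(a_0+\cdots+a_{n-1})$ for $n\in\mathbb{N}$. For every $n\in\mathbb{N}$ let $\mu_n$ denote the law of $s_n$ in $(\mathbb{C}(F),\varphi)$. Then, as $n\to\infty$, the probability measures $\mu_n$ have a $w^*$-limit $\mu$, where $\mu=N(0,1)$ is the centered normal distribution of variance $1$.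
   Context: $\mathbb{N}=\{1,2,\ldots\}$ and $\mathbb{N}_0=\{0,1,2,\ldots\}$. In $\mathbb{C}(F)$ each $g\in F$ is unitary, with $g^*=g^{-1}$, and $e$ is the identity of $F$. The law of the self-adjoint element $s_n$ is the (unique, compactly supported) probability measure $\mu_n$ on $\mathbb{R}$ with $\int_{\mathbb{R}} t^d\,d\mu_n(t)=\varphi(s_n^d)$ for all $d\in\mathbb{N}$. The $w^*$-limit of probability measures means weak convergence: $\int f\,d\mu_n\to\int f\,d\mu$ for every bounded continuous $f:\mathbb{R}\to\mathbb{R}$. *)

theory Defs
  imports "HOL-Library.Poly_Mapping" "HOL-Probability.Probability"
begin

text \<open>
  A group word is a list of letters \<open>(x, b)\<close>; the letter \<open>(x, True)\<close> stands for the generator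
  \<open>x\<close> and \<open>(x, False)\<close> for its formal inverse. The group presented by a set \<open>R\<close> of relations
  \<open>l = r\<close> consists of the classes of words modulo the least congruence (with respect to
  concatenation) that contains \<open>R\<close> and cancels each letter against its formal inverse.
\<close>

type_synonym 'a word = "('a \<times> bool) list"

inductive presented_eq :: "('a word \<times> 'a word) set \<Rightarrow> 'a word \<Rightarrow> 'a word \<Rightarrow> bool"
  for R :: "('a word \<times> 'a word) set" where
  relation: "(l, r) \<in> R \<Longrightarrow> presented_eq R l r"
| cancel: "presented_eq R [(x, b), (x, \<not> b)] []"
| append: "presented_eq R u u' \<Longrightarrow> presented_eq R v v' \<Longrightarrow> presented_eq R (u @ v) (u' @ v')"
| refl: "presented_eq R u u"
| sym: "presented_eq R u v \<Longrightarrow> presented_eq R v u"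
| trans: "presented_eq R u v \<Longrightarrow> presented_eq R v w \<Longrightarrow> presented_eq R u w"

lemma equivp_presented_eq: "equivp (presented_eq R)"
  by (intro equivpI reflpI sympI transpI) (blast intro: presented_eq.intros)+

definition inverse_word :: "'a word \<Rightarrow> 'a word" where
  "inverse_word w = rev (map (\<lambda>(x, b). (x, \<not> b)) w)"

lemma inverse_word_append: "inverse_word (u @ v) = inverse_word v @ inverse_word u"
  by (simp add: inverse_word_def)

lemma inverse_word_inverse_word: "inverse_word (inverse_word w) = w"
  by (induction w) (auto simp: inverse_word_def)

lemma presented_eq_append_inverse: "presented_eq R (w @ inverse_word w) []"
proof (induction w)
  case Nil
  show ?case by (simp add: inverse_word_def presented_eq.refl)
next
  case (Cons a w)
  obtain x b where a: "a = (x, b)" by (cases a)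
  have "presented_eq R ([a] @ ((w @ inverse_word w) @ [(x, \<not> b)])) ([a] @ ([] @ [(x, \<not> b)]))"
    by (intro presented_eq.append presented_eq.refl Cons.IH)
  moreover have "presented_eq R ([a] @ ([] @ [(x, \<not> b)])) []"
    using presented_eq.cancel[of R x b] by (simp add: a)
  ultimately show ?case
    by (simp add: a inverse_word_def) (rule presented_eq.trans)
qed

lemma presented_eq_inverse_append: "presented_eq R (inverse_word w @ w) []"
  using presented_eq_append_inverse[of R "inverse_word w"] by (simp add: inverse_word_inverse_word)

lemma presented_eq_inverse_word:
  assumes "presented_eq R u v"
  shows "presented_eq R (inverse_word u) (inverse_word v)"
proof -
  let ?u = "inverse_word u" and ?v = "inverse_word v"
  have "presented_eq R (?u @ []) (?u @ (v @ ?v))"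
    by (intro presented_eq.append presented_eq.refl)
       (rule presented_eq.sym[OF presented_eq_append_inverse])
  moreover have "presented_eq R (?u @ (v @ ?v)) (?u @ (u @ ?v))"
    by (intro presented_eq.append presented_eq.refl presented_eq.sym[OF assms])
  moreover have "presented_eq R ((?u @ u) @ ?v) ([] @ ?v)"
    by (intro presented_eq.append presented_eq.refl presented_eq_inverse_append)
  ultimately show ?thesis
    by (metis append.assoc append_Nil append_Nil2 presented_eq.trans)
qed

definition thompson_relations :: "(nat word \<times> nat word) set" where
  "thompson_relations =
     {([(n, True), (k, True)], [(k, True), (n + 1, True)]) | k n. 0 \<le> k \<and> k < n}"

quotient_type thompson = "nat word" / "presented_eq thompson_relations"
  by (rule equivp_presented_eq)

text \<open>
  The library constructs the convolution algebra \<open>'a \<Rightarrow>\<^sub>0 'b\<close> (finitely supported functions) for a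
  not necessarily commutative monoid written additively. Therefore the group \<open>F\<close> is written
  additively as well: \<open>x + y\<close> is the product, \<open>0\<close> the identity \<open>e\<close>, and \<open>- x\<close> the inverse. It is
  an instance of \<^class>\<open>group_add\<close>, which does not assume commutativity.
\<close>

instantiation thompson :: group_add
begin

lift_definition zero_thompson :: thompson is "[]" .

lift_definition plus_thompson :: "thompson \<Rightarrow> thompson \<Rightarrow> thompson" is "(@)"
  by (rule presented_eq.append)

lift_definition uminus_thompson :: "thompson \<Rightarrow> thompson" is inverse_word
  by (rule presented_eq_inverse_word)

definition minus_thompson :: "thompson \<Rightarrow> thompson \<Rightarrow> thompson" where
  "minus_thompson x y = x + (- y)"

instance
proof
  fix a b c :: thompson
  show "a + b + c = a + (b + c)"
    by transfer (simp add: presented_eq.refl)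
  show "0 + a = a"
    by transfer (simp add: presented_eq.refl)
  show "a + 0 = a"
    by transfer (simp add: presented_eq.refl)
  show "- a + a = 0"
    by transfer (rule presented_eq_inverse_append)
  show "a + (- b) = a - b"
    by (simp add: minus_thompson_def)
qed

end

lift_definition thompson_gen :: "nat \<Rightarrow> thompson" is "\<lambda>n. [(n, True)]" .

type_synonym 'g group_algebra = "'g \<Rightarrow>\<^sub>0 complex"

abbreviation group_elem :: "'g \<Rightarrow> 'g group_algebra" where
  "group_elem g \<equiv> Poly_Mapping.single g 1"

definition algebra_scale :: "complex \<Rightarrow> 'g group_algebra \<Rightarrow> 'g group_algebra" where
  "algebra_scale c a = Poly_Mapping.map ((*) c) a"

text \<open>The conjugate-linear involution with \<open>g\<^sup>* = g\<^sup>-\<^sup>1\<close> for group elements \<open>g\<close>.\<close>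

lift_definition star :: "'g::group_add group_algebra \<Rightarrow> 'g group_algebra"
  is "\<lambda>a g. cnj (a (- g))"
proof -
  fix a :: "'g \<Rightarrow> complex"
  assume "finite {g. a g \<noteq> 0}"
  moreover have "{g. cnj (a (- g)) \<noteq> 0} \<subseteq> uminus ` {g. a g \<noteq> 0}"
    by (auto intro: image_eqI[where x = "- _"])
  ultimately show "finite {g. cnj (a (- g)) \<noteq> 0}"
    by (meson finite_imageI finite_subset)
qed

text \<open>The linear functional that is \<open>1\<close> at \<open>e\<close> and \<open>0\<close> at all other group elements.\<close>

definition canonical_trace :: "'g::group_add group_algebra \<Rightarrow> complex" where
  "canonical_trace a = Poly_Mapping.lookup a 0"

lemma star_group_elem: "star (group_elem g) = group_elem (- g)"
proof (rule poly_mapping_eqI)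
  fix h :: 'a
  have "g = - h \<longleftrightarrow> - g = h" by (metis minus_minus)
  then show "Poly_Mapping.lookup (star (group_elem g)) h = Poly_Mapping.lookup (group_elem (- g)) h"
    by (simp add: star.rep_eq lookup_single when_def)
qed

lemma canonical_trace_group_elem: "canonical_trace (group_elem g) = (if g = 0 then 1 else 0)"
  by (simp add: canonical_trace_def lookup_single when_def)

lemma canonical_trace_add: "canonical_trace (a + b) = canonical_trace a + canonical_trace b"
  by (simp add: canonical_trace_def lookup_add)

lemma canonical_trace_algebra_scale: "canonical_trace (algebra_scale c a) = c * canonical_trace a"
  by (simp add: canonical_trace_def algebra_scale_def Poly_Mapping.map.rep_eq when_def)

definition is_law :: "'g::group_add group_algebra \<Rightarrow> real measure \<Rightarrow> bool" where
  "is_law a M \<longleftrightarrow>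
     prob_space M \<and> sets M = sets borel \<and>
     (\<exists>K. compact K \<and> measure M K = 1) \<and>
     (\<forall>d\<ge>1. complex_of_real (\<integral>t. t ^ d \<partial>M) = canonical_trace (a ^ d))"

text \<open>
  For self-adjoint \<open>a\<close> exactly one measure \<open>M\<close> satisfies \<open>is_law a M\<close>.
\<close>

definition law :: "'g::group_add group_algebra \<Rightarrow> real measure" where
  "law a = (THE M. is_law a M)"

definition weak_star_limit :: "(nat \<Rightarrow> real measure) \<Rightarrow> real measure \<Rightarrow> bool" where
  "weak_star_limit M N \<longleftrightarrow>
     (\<forall>f :: real \<Rightarrow> real. continuous_on UNIV f \<and> bounded (range f) \<longrightarrow>
        (\<lambda>n. \<integral>t. f t \<partial>(M n)) \<longlonglongrightarrow> (\<integral>t. f t \<partial>N))"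

definition thompson_a :: "nat \<Rightarrow> thompson group_algebra" where
  "thompson_a n = algebra_scale (1 / sqrt 2)
     (group_elem (thompson_gen n) + star (group_elem (thompson_gen n)))"

text \<open>Only \<open>n \<ge> 1\<close> is meaningful here; the value at \<open>n = 0\<close> is the empty sum.\<close>

definition thompson_s :: "nat \<Rightarrow> thompson group_algebra" where
  "thompson_s n = algebra_scale (1 / sqrt n) (\<Sum>i<n. thompson_a i)"

end

theory Submission
  imports Defs "HOL-Real_Asymp.Real_Asymp"
begin

text \<open>
  The proof is by the method of moments. Expanding \<open>s\<^sub>n\<close> to the power \<open>d\<close> shows that
  \<open>\<phi> (s\<^sub>n\<^sup>d)\<close> is \<open>(2n)\<^bsup>-d/2\<^esup>\<close> times the number of \<^emph>\<open>trivial words\<close>: words of length \<open>d\<close> in the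
  letters \<open>g\<^sub>i\<close> and \<open>g\<^sub>i\<^sup>*\<close> with \<open>i < n\<close> that represent the identity. For odd \<open>d\<close> there are none, and
  for \<open>d = 2m\<close> their number is asymptotic to \<open>1 \<sqdot> 3 \<sqdot> \<dots> \<sqdot> (2m - 1) \<sqdot> (2n)\<^sup>m\<close>
  (\<open>trivial_words_even_asymptotics\<close>), which gives the moments of \<open>N(0,1)\<close>.

  The count rests on the action of \<open>F\<close> on the line in which \<open>g\<^sub>n\<close> fixes the points below \<open>n\<close> and
  translates the points above \<open>n + 1\<close> by \<open>1\<close>. If the indices of a trivial word leave a gap that is
  more than twice as long as the word, up to a constant, then a point in the middle of this gap is moved
  by the exponent sum of the letters below the gap, so this sum is zero (\<open>low_sum_gap\<close>), and the
  number of these letters is even. Hence the sorted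
  indices of a trivial word of length \<open>2m + 2\<close> form \<open>m + 1\<close> pairs of close numbers. Words in which
  two of these pairs are close to each other have at most \<open>m\<close> clusters of indices, so they number
  \<open>O(n\<^sup>m)\<close> and are negligible. In all other trivial words the first letter has one partner of
  nearby index; moved next to this partner by the relations of \<open>F\<close>, it must cancel against it
  (\<open>isolated_pair_is_inserted\<close>), and a trivial word of length \<open>2m\<close> remains. Conversely, a trivial
  word of length \<open>2m\<close>, one of \<open>2m + 1\<close> places for the partner, a sign, and an index \<open>i < n\<close> far from
  the indices of the word determine a trivial word of length \<open>2m + 2\<close>
  (\<open>word_value_insert_pair\<close>). So the number of trivial words grows by a factor asymptotic to
  \<open>2n (2m + 1)\<close> from length \<open>2m\<close> to length \<open>2m + 2\<close>.

  It remains to pass from moments to measures. The definition of the law as \<open>the\<close> measure with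
  given moments is meaningful only if such a measure exists and is unique. For existence, rescale
  \<open>s\<^sub>n\<close> to \<open>T - U\<close> with \<open>T + U = 1\<close>, where \<open>T\<close> and \<open>U\<close> are positive multiples of
  \<open>\<Sum> (1 + g\<^sub>i)\<^sup>* (1 + g\<^sub>i)\<close> and \<open>\<Sum> (1 - g\<^sub>i)\<^sup>* (1 - g\<^sub>i)\<close>. Then \<open>\<phi> (T\<^sup>k U\<^sup>l) \<ge> 0\<close>, and
  Hausdorff's moment problem on \<open>[0, 1]\<close> has a solution for the moments of \<open>T\<close>
  (\<open>hausdorff_moment_problem\<close>). Uniqueness and the final weak convergence both follow from the
  same estimate: the characteristic function is approximated by Taylor polynomials whose
  coefficients are moments (\<open>char_tendsto_of_moments\<close>), so that the uniqueness and
  continuity theorems of Levy apply.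
\<close>

section \<open>Words in the generators and the piecewise linear action\<close>

definition letter :: "nat \<times> bool \<Rightarrow> thompson" where
  "letter x = (if snd x then thompson_gen (fst x) else - thompson_gen (fst x))"

definition word_value :: "nat word \<Rightarrow> thompson" where
  "word_value w = sum_list (map letter w)"

lemma word_value_simps [simp]:
  "word_value [] = 0" "word_value (x # w) = letter x + word_value w" "word_value (u @ v) = word_value u + word_value v"
  by (simp_all add: word_value_def)

lemma word_value_eq_abs: "word_value w = abs_thompson w"
proof (induction w)
  case Nil
  show ?case by (simp add: zero_thompson_def)
next
  case (Cons x w)
  have "letter x = abs_thompson [x]"
    by (cases x) (simp add: letter_def thompson_gen.abs_eq uminus_thompson.abs_eq inverse_word_def)
  then show ?case
    using Cons by (simp add: plus_thompson.abs_eq)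
qed

text \<open>
  The generator \<open>g\<^sub>k\<close> acts by the homeomorphism of the line that is the identity up to \<open>k\<close>, has slope
  \<open>2\<close> on \<open>[k, k + 1]\<close> and is \<open>y \<mapsto> y + 1\<close> above \<open>k + 1\<close>. Words act from the right, by \<open>fold\<close>; with the
  opposite order the defining relations of \<open>F\<close> would fail.
\<close>

definition letter_act :: "nat \<times> bool \<Rightarrow> real \<Rightarrow> real" where
  "letter_act x y = (let k = real (fst x) in
     if y \<le> k then y
     else if snd x then (if y \<le> k + 1 then 2 * y - k else y + 1)
     else (if y \<le> k + 2 then (y + k) / 2 else y - 1))"

text \<open>
  The relation holds because \<open>g\<^sub>k\<close> translates the support of \<open>g\<^sub>n\<close> by \<open>1\<close> if \<open>k < n\<close>, which turns the
  map of \<open>g\<^sub>n\<close> into the map of \<open>g\<^sub>n\<^sub>+\<^sub>1\<close>.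
\<close>

lemma fold_letter_act_presented_eq:
  "presented_eq thompson_relations u v \<Longrightarrow> fold letter_act u = fold letter_act v"
proof (induction rule: presented_eq.induct)
  case (relation l r)
  then obtain k n where "l = [(n, True), (k, True)]" "r = [(k, True), (n + 1, True)]" "k < n"
    by (auto simp: thompson_relations_def)
  moreover from this have "real k + 1 \<le> real n" by simp
  then have "letter_act (k, True) (letter_act (n, True) y) = letter_act (n + 1, True) (letter_act (k, True) y)" for y
    by (simp add: letter_act_def Let_def)
  ultimately show ?case
    by (simp add: fun_eq_iff)
next
  case (cancel x b)
  have "letter_act (x, \<not> b) (letter_act (x, b) y) = y" for y
    by (cases b) (simp_all add: letter_act_def Let_def field_simps)
  then show ?case
    by (simp add: fun_eq_iff)
qed simp_all

lemma fold_letter_act_cong: "word_value u = word_value v \<Longrightarrow> fold letter_act u = fold letter_act v"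
  unfolding word_value_eq_abs by (intro fold_letter_act_presented_eq) (simp add: thompson.abs_eq_iff)

definition exponent :: "bool \<Rightarrow> int" where
  "exponent b = (if b then 1 else - 1)"

definition low_sum :: "real \<Rightarrow> nat word \<Rightarrow> int" where
  "low_sum y w = (\<Sum>x\<leftarrow>w. if real (fst x) < y then exponent (snd x) else 0)"

lemma low_sum_simps [simp]:
  "low_sum y [] = 0"
  "low_sum y (x # w) = (if real (fst x) < y then exponent (snd x) else 0) + low_sum y w"
  "low_sum y (u @ v) = low_sum y u + low_sum y v"
  by (simp_all add: low_sum_def)

definition far :: "nat \<Rightarrow> real \<Rightarrow> nat word \<Rightarrow> bool" where
  "far c y w \<longleftrightarrow> (\<forall>x\<in>set w. real (fst x) + c < y \<or> y + c < real (fst x))"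

text \<open>
  A point that stays away from all indices is fixed by the letters of larger index and moved by
  \<open>\<plusminus>1\<close> by the letters of smaller index. The margin \<open>length w + 1\<close> leaves room for the drift of the
  point, and \<open>\<bar>y - p\<bar>\<close> for a start away from the centre \<open>p\<close> of the gap.
\<close>

lemma fold_letter_act_far:
  fixes y p :: real
  assumes "far c p w" "length w + 1 + \<bar>y - p\<bar> \<le> c"
  shows "fold letter_act w y = y + low_sum p w"
  using assms
proof (induction w arbitrary: y)
  case Nil
  then show ?case by simp
next
  case (Cons x w)
  have far: "far c p w" using Cons.prems by (auto simp: far_def)
  obtain k b where x: "x = (k, b)" by (cases x)
  from Cons.prems have "real k + c < p \<or> p + c < real k" by (simp add: far_def x)
  with Cons.prems have *: "letter_act x y = y + (if real (fst x) < p then exponent (snd x) else 0)"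
    by (auto simp: letter_act_def Let_def x exponent_def abs_if split: if_splits)
  have "\<bar>letter_act x y - p\<bar> \<le> \<bar>y - p\<bar> + 1"
    by (auto simp: * exponent_def)
  then show ?case
    using Cons.IH[OF far, of "letter_act x y"] Cons.prems by (simp add: *)
qed

text \<open>
  The obstruction that a trivial word has to pass: its action fixes the middle of a gap.
\<close>

lemma low_sum_gap:
  assumes "word_value w = 0" "far (length w + 1) y w"
  shows "low_sum y w = 0"
proof -
  have "fold letter_act w y = y + low_sum y w"
    by (rule fold_letter_act_far[OF assms(2)]) simp
  moreover have "fold letter_act w = fold letter_act []"
    by (rule fold_letter_act_cong) (simp add: assms)
  ultimately show ?thesis by simp
qed

lemma even_low_sum: "even (low_sum y w) \<longleftrightarrow> even (length (filter (\<lambda>x. real (fst x) < y) w))"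
  by (induction w) (auto simp: exponent_def)

section \<open>Moving a letter past letters of distant index\<close>

lemma thompson_gen_relation: "k < n \<Longrightarrow> thompson_gen n + thompson_gen k = thompson_gen k + thompson_gen (n + 1)"
  by transfer (auto intro!: presented_eq.relation simp: thompson_relations_def)

text \<open>
  The defining relation and its consequences for inverses, in the form used to move a letter to the
  right: passing a smaller index changes the index of the moving letter, passing a larger index
  changes the index of the letter that is passed.
\<close>

lemma letter_commute:
  assumes "k < n"
  shows "letter (n, b) + letter (k, True) = letter (k, True) + letter (n + 1, b)"
    and "letter (n + 1, b) + letter (k, False) = letter (k, False) + letter (n, b)"
    and "letter (k, True) + letter (n + 1, b) = letter (n, b) + letter (k, True)"
    and "letter (k, False) + letter (n, b) = letter (n + 1, b) + letter (k, False)"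
proof -
  have conj: "- x + y' + x = y" "y + - x = - x + y'" "x + y = y' + x" "- x + y' = y + - x"
    if "y' + x = x + y" for x y y' :: thompson
    using that by (metis add.assoc minus_add_cancel add_minus_cancel add.right_inverse add_0_right)+
  have 0: "thompson_gen n + thompson_gen k = thompson_gen k + thompson_gen (n + 1)"
    by (rule thompson_gen_relation[OF assms])
  have 1: "letter (n, b) + thompson_gen k = thompson_gen k + letter (n + 1, b)"
  proof (cases b)
    case True
    then show ?thesis by (simp add: letter_def thompson_gen_relation[OF assms])
  next
    case False
    have "- thompson_gen n + thompson_gen k =
        - thompson_gen n + (thompson_gen k + thompson_gen (n + 1)) + - thompson_gen (n + 1)"
      by (metis add.assoc add.right_inverse add_0_right)
    also have "\<dots> = - thompson_gen n + (thompson_gen n + thompson_gen k) + - thompson_gen (n + 1)"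
      by (simp only: 0)
    also have "\<dots> = thompson_gen k + - thompson_gen (n + 1)"
      by (metis add.assoc minus_add_cancel)
    finally show ?thesis using False by (simp add: letter_def)
  qed
  show "letter (n, b) + letter (k, True) = letter (k, True) + letter (n + 1, b)"
    and "letter (n + 1, b) + letter (k, False) = letter (k, False) + letter (n, b)"
    and "letter (k, True) + letter (n + 1, b) = letter (n, b) + letter (k, True)"
    and "letter (k, False) + letter (n, b) = letter (n + 1, b) + letter (k, False)"
    using 1 conj[OF 1] by (simp_all add: letter_def[of "(k, _)"] del: add_uminus_conv_diff)
qed

definition shift_above :: "nat \<Rightarrow> bool \<Rightarrow> nat word \<Rightarrow> nat word" where
  "shift_above i up w = map (\<lambda>(k, b). (if k \<le> i then k else if up then k + 1 else k - 1, b)) w"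

lemma shift_above_simps [simp]:
  "shift_above i up [] = []"
  "shift_above i up (x # w) =
     (if fst x \<le> i then fst x else if up then fst x + 1 else fst x - 1, snd x) # shift_above i up w"
  "length (shift_above i up w) = length w"
  by (simp_all add: shift_above_def case_prod_unfold)

text \<open>
  Letters of smaller index accumulate in the index of the moving letter, which becomes
  \<open>j + low_sum i w\<close>; letters of larger index are shifted by one against the sign of the moving letter.
  The pivot \<open>i\<close> separates smaller from larger indices and stays fixed in the induction, while the
  current index \<open>j\<close> drifts.
\<close>

lemma letter_push:
  assumes "far c (real i) w" "length w + 1 + \<bar>real j - real i\<bar> \<le> c"
  shows "letter (j, b) + word_value w =
    word_value (shift_above i (\<not> b) w) + letter (nat (int j + low_sum i w), b)"
  using assms
proof (induction w arbitrary: j)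
  case Nil
  then show ?case by simp
next
  case (Cons x w)
  obtain k e where x: "x = (k, e)" by (cases x)
  have far: "far c i w" using Cons.prems by (auto simp: far_def)
  from Cons.prems consider "real k + c < i" | "real i + c < k" by (auto simp: far_def x)
  then show ?case
  proof cases
    case 1
    with Cons.prems have k: "k + 1 < j" "k < i" by (auto simp: abs_if split: if_splits)
    define j' where "j' = (if e then j + 1 else j - 1)"
    have *: "letter (j, b) + letter (k, e) = letter (k, e) + letter (j', b)"
      using k letter_commute(1)[of k j b] letter_commute(2)[of k "j - 1" b]
      by (cases e) (auto simp: j'_def)
    have "real j' = real j + (if e then 1 else - 1)"
      using k by (auto simp: j'_def)
    then have IH: "letter (j', b) + word_value w =
        word_value (shift_above i (\<not> b) w) + letter (nat (int j' + low_sum i w), b)"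
      using Cons.prems by (intro Cons.IH[OF far]) auto
    have **: "int j' = int j + exponent e" using k by (auto simp: j'_def exponent_def)
    have "letter (j, b) + word_value (x # w) = (letter (j, b) + letter (k, e)) + word_value w"
      by (simp add: x add.assoc)
    also have "\<dots> = letter (k, e) + (letter (j', b) + word_value w)"
      by (simp only: * add.assoc)
    finally show ?thesis
      using k by (simp add: IH x ** add.assoc)
  next
    case 2
    with Cons.prems have k: "j + 1 < k" "i < k" by (auto simp: abs_if split: if_splits)
    define k' where "k' = (if b then k - 1 else k + 1)"
    have *: "letter (j, b) + letter (k, e) = letter (k', e) + letter (j, b)"
      using k letter_commute(3)[of j "k - 1" e] letter_commute(4)[of j k e]
      by (cases b) (auto simp: k'_def)
    have IH: "letter (j, b) + word_value w =
        word_value (shift_above i (\<not> b) w) + letter (nat (int j + low_sum i w), b)"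
      using Cons.prems by (intro Cons.IH[OF far]) auto
    have "letter (j, b) + word_value (x # w) = (letter (j, b) + letter (k, e)) + word_value w"
      by (simp add: x add.assoc)
    also have "\<dots> = letter (k', e) + (letter (j, b) + word_value w)"
      by (simp only: * add.assoc)
    finally show ?thesis
      using k by (simp add: IH x k'_def add.assoc)
  qed
qed

section \<open>Trivial words pair up their indices\<close>

definition trivial_words :: "nat \<Rightarrow> nat \<Rightarrow> nat word set" where
  "trivial_words d n = {w. length w = d \<and> set w \<subseteq> {..<n} \<times> UNIV \<and> word_value w = 0}"

lemma finite_trivial_words [simp]: "finite (trivial_words d n)"
  by (rule finite_subset[OF _ finite_lists_length_eq[of "{..<n} \<times> UNIV" d]])
     (auto simp: trivial_words_def)

lemma length_filter_fst_eq_card_sorted: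
  fixes w :: "nat word"
  shows "length (filter (\<lambda>x. P (fst x)) w) = card {p. p < length w \<and> P (sort (map fst w) ! p)}"
proof -
  have "length (filter (\<lambda>x. P (fst x)) w) = length (filter P (map fst w))"
    by (simp add: filter_map o_def)
  also have "\<dots> = size (filter_mset P (mset (map fst w)))"
    by (metis mset_filter size_mset)
  also have "\<dots> = size (filter_mset P (mset (sort (map fst w))))"
    by (simp only: mset_sort)
  also have "\<dots> = length (filter P (sort (map fst w)))"
    by (metis mset_filter size_mset)
  finally show ?thesis
    by (simp add: length_filter_conv_card)
qed

text \<open>
  Otherwise there would be a gap above the first \<open>q + 1\<close> sorted indices. Their exponent sum would be
  zero by \<open>low_sum_gap\<close>, although an odd number of signs does not add up to zero.
\<close>

lemma sorted_index_pairs: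
  assumes "word_value w = 0" and d: "d = length w" and q: "even q" "q + 1 < d"
  shows "sort (map fst w) ! (q + 1) \<le> sort (map fst w) ! q + 2 * (d + 1)"
proof (rule ccontr)
  let ?ys = "sort (map fst w)"
  assume "\<not> ?thesis"
  then have gap: "?ys ! (q + 1) > ?ys ! q + 2 * (d + 1)" by simp
  \<comment> \<open>More than \<open>d + 1\<close> away from both ends of the gap.\<close>
  define y where "y = real (?ys ! q) + d + 3 / 2"
  have lo: "?ys ! p \<le> ?ys ! q" if "p \<le> q" for p
    using that q d by (intro sorted_nth_mono) auto
  have hi: "?ys ! (q + 1) \<le> ?ys ! p" if "q < p" "p < d" for p
    using that q d by (intro sorted_nth_mono) auto
  have split: "(p \<le> q \<and> real (?ys ! p) + (d + 1) < y) \<or> (q < p \<and> y + (d + 1) < real (?ys ! p))"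
    if "p < d" for p
  proof (cases "p \<le> q")
    case True
    with lo[of p] show ?thesis by (simp add: y_def)
  next
    case False
    with hi[of p] that gap have "?ys ! p \<ge> ?ys ! q + 2 * (d + 1) + 1" by simp
    then have "real (?ys ! q + 2 * (d + 1) + 1) \<le> real (?ys ! p)"
      by (simp only: of_nat_le_iff)
    with False show ?thesis by (simp add: y_def)
  qed
  have "far (length w + 1) y w"
    unfolding far_def
  proof
    fix x assume "x \<in> set w"
    then have "fst x \<in> set ?ys" by simp
    then obtain p where "p < d" "?ys ! p = fst x"
      unfolding in_set_conv_nth by (auto simp: d)
    with split[of p] show "real (fst x) + real (length w + 1) < y \<or> y + real (length w + 1) < real (fst x)"
      by (simp only: d) blast
  qed
  then have "low_sum y w = 0"
    by (rule low_sum_gap[OF assms(1)])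
  then have "even (length (filter (\<lambda>x. real (fst x) < y) w))"
    using even_low_sum[of y w] by simp
  also have "length (filter (\<lambda>x. real (fst x) < y) w) = card {p. p < d \<and> real (?ys ! p) < y}"
    using length_filter_fst_eq_card_sorted[of "\<lambda>k. real k < y" w] by (simp add: d)
  also have "{p. p < d \<and> real (?ys ! p) < y} = {..q}"
  proof (intro equalityI subsetI)
    fix p assume "p \<in> {p. p < d \<and> real (?ys ! p) < y}"
    with split[of p] show "p \<in> {..q}" by auto
  next
    fix p assume "p \<in> {..q}"
    with split[of p] q show "p \<in> {p. p < d \<and> real (?ys ! p) < y}" by auto
  qed
  finally show False
    using q by simp
qed

text \<open>
  Words whose indices are covered by \<open>c\<close> intervals of length \<open>L\<close> that start below \<open>n\<close>. There are
  \<open>n\<^sup>c\<close> choices for the starting points and a bounded number of words for each choice.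
\<close>

definition clustered_words :: "nat \<Rightarrow> nat \<Rightarrow> nat \<Rightarrow> nat \<Rightarrow> nat word set" where
  "clustered_words d n c L = {w. length w = d \<and>
     (\<exists>ss. length ss = c \<and> set ss \<subseteq> {..<n} \<and> (\<forall>x\<in>set w. \<exists>s\<in>set ss. s \<le> fst x \<and> fst x \<le> s + L))}"

lemma clustered_words_finite_card:
  shows finite_clustered_words: "finite (clustered_words d n c L)"
    and card_clustered_words_le: "card (clustered_words d n c L) \<le> (2 * (c * (L + 1))) ^ d * n ^ c"
proof -
  define I where "I ss = (\<Union>s\<in>set ss. {s..s + L}) \<times> (UNIV :: bool set)" for ss
  define W where "W ss = {w :: nat word. set w \<subseteq> I ss \<and> length w = d}" for ss
  let ?S = "{ss. set ss \<subseteq> {..<n} \<and> length ss = c}"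
  have "finite (I ss)" for ss by (simp add: I_def)
  then have fin: "finite (W ss)" "finite ?S" for ss
    unfolding W_def by (simp_all only: finite_lists_length_eq finite_lessThan)
  have sub: "clustered_words d n c L \<subseteq> (\<Union>ss\<in>?S. W ss)"
  proof
    fix w assume "w \<in> clustered_words d n c L"
    then obtain ss where "length w = d" "ss \<in> ?S"
      and cover: "\<And>x. x \<in> set w \<Longrightarrow> \<exists>s\<in>set ss. s \<le> fst x \<and> fst x \<le> s + L"
      unfolding clustered_words_def by blast
    moreover have "set w \<subseteq> I ss"
    proof
      fix x assume "x \<in> set w"
      from cover[OF this] show "x \<in> I ss" by (cases x) (auto simp: I_def)
    qed
    ultimately show "w \<in> (\<Union>ss\<in>?S. W ss)"
      unfolding W_def by blast
  qed
  show "finite (clustered_words d n c L)"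
    by (rule finite_subset[OF sub]) (use fin in simp)
  have W: "card (W ss) \<le> (2 * (c * (L + 1))) ^ d" if "ss \<in> ?S" for ss
  proof -
    have "card (\<Union>s\<in>set ss. {s..s + L}) \<le> (\<Sum>s\<in>set ss. card {s..s + L})"
      by (rule card_UN_le) simp
    also have "\<dots> = card (set ss) * (L + 1)" by simp
    also have "\<dots> \<le> c * (L + 1)"
      using card_length[of ss] that by (intro mult_le_mono1) simp
    finally have "card (I ss) \<le> 2 * (c * (L + 1))"
      by (simp add: I_def card_cartesian_product)
    then have "card (I ss) ^ d \<le> (2 * (c * (L + 1))) ^ d"
      by (rule power_mono) simp
    moreover have "card (W ss) = card (I ss) ^ d"
      unfolding W_def by (rule card_lists_length_eq) (simp add: I_def)
    ultimately show ?thesis by simp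
  qed
  have "card (clustered_words d n c L) \<le> card (\<Union>ss\<in>?S. W ss)"
    using fin by (intro card_mono sub) simp
  also have "\<dots> \<le> (\<Sum>ss\<in>?S. card (W ss))"
    using fin by (intro card_UN_le) simp
  also have "\<dots> \<le> (\<Sum>ss\<in>?S. (2 * (c * (L + 1))) ^ d)"
    by (intro sum_mono W)
  also have "\<dots> = (2 * (c * (L + 1))) ^ d * n ^ c"
    by (simp add: card_lists_length_eq)
  finally show "card (clustered_words d n c L) \<le> (2 * (c * (L + 1))) ^ d * n ^ c" .
qed

definition near :: "nat \<Rightarrow> nat \<Rightarrow> nat \<Rightarrow> bool" where
  "near e i k \<longleftrightarrow> k \<le> i + e \<and> i \<le> k + e"

lemma far_iff_not_near: "far e (real i) w \<longleftrightarrow> (\<forall>x\<in>set w. \<not> near e i (fst x))"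
  by (auto simp: far_def near_def not_le simp flip: of_nat_add)

text \<open>
  The sorted indices form \<open>m + 1\<close> pairs of diameter at most \<open>L\<close>. If two consecutive pairs are at distance
  at most \<open>E\<close>, one interval covers both, and \<open>m\<close> intervals suffice. Otherwise the letters near \<open>x\<close>
  are \<open>x\<close> itself and the other member of its pair, whatever the radius between \<open>L\<close> and \<open>E\<close>. Both ends of this
  range are used later: \<open>L\<close> bounds the distance to the partner, \<open>E\<close> the distance to all other letters.
\<close>

lemma clustered_or_isolated_pairs:
  assumes w: "w \<in> trivial_words (2 * m + 2) n" and L: "L = 2 * (2 * m + 3)" and E: "L \<le> e" "e \<le> E"
    and nc: "w \<notin> clustered_words (2 * m + 2) n m (2 * L + E)" and x: "x \<in> set w"
  shows "length (filter (\<lambda>x'. near e (fst x) (fst x')) w) = 2"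
proof -
  let ?ys = "sort (map fst w)"
  have len: "length w = 2 * m + 2" and set: "set w \<subseteq> {..<n} \<times> UNIV" and ev: "word_value w = 0"
    using w by (auto simp: trivial_words_def)
  have mono: "?ys ! p \<le> ?ys ! p'" if "p \<le> p'" "p' < 2 * m + 2" for p p'
    using that by (intro sorted_nth_mono) (auto simp: len)
  have pair: "?ys ! (2 * j + 1) \<le> ?ys ! (2 * j) + L" if "j \<le> m" for j
    using sorted_index_pairs[OF ev HOL.refl, of "2 * j"] that by (simp add: len L)
  have pos: "\<exists>p. p < 2 * m + 2 \<and> ?ys ! p = fst x'" if "x' \<in> set w" for x'
  proof -
    have "fst x' \<in> set ?ys" using that by simp
    then show ?thesis unfolding in_set_conv_nth by (auto simp: len)
  qed
  have sep: "?ys ! (2 * q - 1) + E < ?ys ! (2 * q)" if q: "0 < q" "q \<le> m" for q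
  proof (rule ccontr)
    assume "\<not> ?thesis"
    then have close: "?ys ! (2 * q) \<le> ?ys ! (2 * q - 1) + E" by simp
    \<comment> \<open>Left ends of all pairs except number \<open>q\<close>, which the interval of its predecessor covers.\<close>
    define ss where "ss = map (\<lambda>j. ?ys ! (2 * j)) ([0..<q] @ [q + 1..<m + 1])"
    have "length ss = m" using q by (simp add: ss_def)
    moreover have "set ss \<subseteq> {..<n}"
    proof -
      have "?ys ! (2 * j) \<in> set ?ys" if "j \<le> m" for j
        using that by (intro nth_mem) (simp add: len)
      then have "?ys ! (2 * j) < n" if "j \<le> m" for j
        using that set by fastforce
      then show ?thesis
        using q by (auto simp: ss_def)
    qed
    moreover have "\<exists>s\<in>set ss. s \<le> fst x' \<and> fst x' \<le> s + (2 * L + E)" if x': "x' \<in> set w" for x'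
    proof -
      obtain p where p: "p < 2 * m + 2" "?ys ! p = fst x'" using pos[OF x'] by blast
      define j where "j = p div 2"
      have j: "j \<le> m" "2 * j \<le> p" "p \<le> 2 * j + 1" using p by (auto simp: j_def)
      have bounds: "?ys ! (2 * j) \<le> fst x'" "fst x' \<le> ?ys ! (2 * j) + L"
        using mono[of "2 * j" p] mono[of p "2 * j + 1"] pair[of j] j p by auto
      show ?thesis
      proof (cases "j = q")
        case False
        with j have "j \<in> set ([0..<q] @ [q + 1..<m + 1])" by auto
        then have "?ys ! (2 * j) \<in> set ss" unfolding ss_def set_map by (rule imageI)
        with bounds show ?thesis by (intro bexI[of _ "?ys ! (2 * j)"]) auto
      next
        case True
        have in_ss: "?ys ! (2 * (q - 1)) \<in> set ss" using q by (auto simp: ss_def)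
        have "?ys ! (2 * (q - 1)) \<le> ?ys ! (2 * q)"
          using q by (intro mono) auto
        moreover have "?ys ! (2 * q - 1) \<le> ?ys ! (2 * (q - 1)) + L"
          using pair[of "q - 1"] q by (cases q) auto
        ultimately show ?thesis
          using bounds close True by (intro bexI[OF _ in_ss]) auto
      qed
    qed
    ultimately have "w \<in> clustered_words (2 * m + 2) n m (2 * L + E)"
      unfolding clustered_words_def using len by blast
    with nc show False by simp
  qed
  obtain p where p: "p < 2 * m + 2" "?ys ! p = fst x" using pos[OF x] by blast
  define j where "j = p div 2"
  have j: "j \<le> m" "2 * j \<le> p" "p \<le> 2 * j + 1" using p by (auto simp: j_def)
  have bounds: "?ys ! (2 * j) \<le> fst x" "fst x \<le> ?ys ! (2 * j + 1)"
    using mono[of "2 * j" p] mono[of p "2 * j + 1"] j p by auto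
  have "{p'. p' < length w \<and> near e (fst x) (?ys ! p')} = {2 * j, 2 * j + 1}"
  proof (intro equalityI subsetI)
    fix p' assume "p' \<in> {p'. p' < length w \<and> near e (fst x) (?ys ! p')}"
    then have p': "p' < 2 * m + 2" "?ys ! p' \<le> fst x + e" "fst x \<le> ?ys ! p' + e"
      by (auto simp: len near_def)
    have "\<not> p' < 2 * j"
    proof
      assume "p' < 2 * j"
      then have "?ys ! p' \<le> ?ys ! (2 * j - 1)" using j by (intro mono) auto
      then show False using sep[of j] \<open>p' < 2 * j\<close> j bounds p' E by auto
    qed
    moreover have "\<not> p' > 2 * j + 1"
    proof
      assume gt: "p' > 2 * j + 1"
      then have "?ys ! (2 * (j + 1)) \<le> ?ys ! p'" using p' by (intro mono) auto
      then show False using sep[of "j + 1"] gt j bounds p' E by auto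
    qed
    ultimately show "p' \<in> {2 * j, 2 * j + 1}" by auto
  next
    fix p' assume "p' \<in> {2 * j, 2 * j + 1}"
    moreover have "?ys ! (2 * j) \<le> ?ys ! (2 * j + 1)" using j by (intro mono) auto
    ultimately show "p' \<in> {p'. p' < length w \<and> near e (fst x) (?ys ! p')}"
      using bounds pair[of j] j E by (auto simp: len near_def)
  qed
  then show ?thesis
    using length_filter_fst_eq_card_sorted[of "near e (fst x)" w] by simp
qed

section \<open>Inserting and removing a cancelling pair\<close>

lemma far_mono: "far c y w \<Longrightarrow> c' \<le> c \<Longrightarrow> far c' y w"
  by (force simp: far_def)

lemma far_append [simp]: "far c y (u @ v) \<longleftrightarrow> far c y u \<and> far c y v"
  and far_Cons: "far c y (x # w) \<longleftrightarrow> (real (fst x) + c < y \<or> y + c < real (fst x)) \<and> far c y w"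
  and far_Nil [simp]: "far c y []"
  by (auto simp: far_def)

lemma far_take: "far c y w \<Longrightarrow> far c y (take j w)"
  and far_drop: "far c y w \<Longrightarrow> far c y (drop j w)"
  by (auto simp: far_def dest: in_set_takeD in_set_dropD)

lemma far_shift_above:
  assumes "far (c + 1) (real i) w"
  shows "far c (real i) (shift_above i up w)"
  unfolding far_def
proof
  fix x assume "x \<in> set (shift_above i up w)"
  then obtain k b where k: "(k, b) \<in> set w"
    and x: "x = (if k \<le> i then k else if up then k + 1 else k - 1, b)"
    by (auto simp: shift_above_def)
  from k assms have "k + c + 1 < i \<or> i + c + 1 < k"
    by (force simp: far_def)
  then have "fst x + c < i \<or> i + c < fst x"
    by (auto simp: x)
  then show "real (fst x) + real c < real i \<or> real i + real c < real (fst x)"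
    by linarith
qed

lemma shift_above_inverse:
  assumes "far 1 (real i) w"
  shows "shift_above i (\<not> up) (shift_above i up w) = w"
  using assms
proof (induction w)
  case (Cons x w)
  then show ?case by (cases x) (auto simp: far_Cons)
qed simp

lemma low_sum_shift_above:
  assumes "far 1 (real i) w"
  shows "low_sum i (shift_above i up w) = low_sum i w"
  using assms
proof (induction w)
  case (Cons x w)
  then show ?case by (cases x) (auto simp: far_Cons)
qed simp

lemma abs_low_sum_le: "\<bar>low_sum y w\<bar> \<le> int (length w)"
  by (induction w) (auto simp: exponent_def)

lemma low_sum_cong_far:
  assumes "far c p w" "\<bar>y - p\<bar> \<le> c"
  shows "low_sum y w = low_sum p w"
  using assms
proof (induction w)
  case (Cons x w)
  then show ?case by (auto simp: far_Cons)
qed simp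

text \<open>
  If there are letters far below \<open>i\<close> at all, then \<open>i\<close> exceeds the length of the word. Hence truncation by
  \<open>nat\<close> never occurs in the index of a moving letter.
\<close>

lemma index_plus_low_sum_nonneg:
  assumes "far c (real i) w" "length w \<le> c"
  shows "0 \<le> int i + low_sum i w"
proof (cases "i \<le> c")
  case True
  then have "low_sum i w = 0"
    using assms(1) by (induction w) (auto simp: far_Cons)
  then show ?thesis by simp
next
  case False
  then show ?thesis using abs_low_sum_le[of i w] assms(2) by linarith
qed

text \<open>
  The word that reduces to \<open>u\<close> when its first letter \<open>(i, b)\<close> is moved to the right past the next \<open>j\<close>
  letters and cancelled against the letter that it meets there. The shift anticipates the change
  that the moving letter causes in these letters, see \<open>letter_push\<close>.
\<close>

definition insert_pair :: "nat \<Rightarrow> bool \<Rightarrow> nat \<Rightarrow> nat word \<Rightarrow> nat word" where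
  "insert_pair j b i u = (i, b) # shift_above i b (take j u) @
     (nat (int i + low_sum i (take j u)), \<not> b) # drop j u"

lemma letter_inverse [simp]: "letter (k, b) + (letter (k, \<not> b) + g) = g"
  by (cases b) (simp_all add: letter_def flip: add.assoc)

lemma letter_inverse' [simp]: "letter (k, b) + letter (k, \<not> b) = 0"
  using letter_inverse[of k b 0] by simp

lemma word_value_insert_pair:
  assumes "far (length u + 2) (real i) u"
  shows "word_value (insert_pair j b i u) = word_value u"
proof -
  let ?v = "take j u"
  let ?B = "shift_above i b ?v"
  have far: "far (length u + 2) i ?v" using assms by (rule far_take)
  then have far1: "far 1 i ?v" by (rule far_mono) simp
  have "far (length u + 1) i ?B" using far by (intro far_shift_above) simp
  then have "letter (i, b) + word_value ?B =
      word_value (shift_above i (\<not> b) ?B) + letter (nat (int i + low_sum i ?B), b)"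
    by (rule letter_push) simp
  also have "\<dots> = word_value ?v + letter (nat (int i + low_sum i ?v), b)"
    by (simp only: shift_above_inverse[OF far1] low_sum_shift_above[OF far1])
  finally have "word_value (insert_pair j b i u) = word_value ?v + word_value (drop j u)"
    by (simp add: insert_pair_def add.assoc[symmetric]) (simp add: add.assoc)
  also have "\<dots> = word_value u"
    by (simp flip: word_value_simps(3))
  finally show ?thesis .
qed

text \<open>
  A first letter whose only nearby letter is \<open>(i', b')\<close> must cancel against it. The signs are opposite because
  the exponent sums at the gaps below and above the pair are both zero. After the first letter has been moved
  next to its partner, the word is \<open>B' (p, b) (i', \<not> b) C\<close>. All letters of \<open>B'\<close> and \<open>C\<close> act
  near \<open>i\<close> as translations, so the two middle letters together act there as one translation. It fixes
  \<open>min p i'\<close>, hence it is the identity, and this forces \<open>p = i'\<close>.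
\<close>

lemma isolated_pair_is_inserted:
  assumes ev: "word_value ((i, b) # B @ (i', b') # C) = 0"
    and d: "d = length B + length C + 2" and L: "L = 2 * (d + 1)"
    and far: "far (4 * L) (real i) B" "far (4 * L) (real i) C" and near: "near L i i'"
  shows "(i, b) # B @ (i', b') # C =
    insert_pair (length B) b i (shift_above i (\<not> b) B @ C)"
proof -
  let ?w = "(i, b) # B @ (i', b') # C"
  have len: "length B + length C + 2 = d" by (simp add: d)
  have near': "\<bar>real i' - real i\<bar> \<le> L"
    using near unfolding near_def by (auto simp: abs_le_iff simp flip: of_nat_add)
  have b': "b' = (\<not> b)"
  proof -
    \<comment> \<open>Points in the gaps below and above the pair, at distance more than \<open>d + 1\<close> from \<open>i'\<close>.\<close>
    let ?y1 = "real i - L - d - 2" and ?y2 = "real i + L + d + 2"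
    have "far (d + 1) ?y1 ?w" "far (d + 1) ?y2 ?w"
      using far near' unfolding far_def L by force+
    moreover have "length ?w = d" by (simp add: d)
    then have "low_sum y ?w = 0" if "far (d + 1) y ?w" for y
      by (intro low_sum_gap[OF ev]) (simp only: that)
    ultimately have "low_sum ?y1 ?w = 0" "low_sum ?y2 ?w = 0"
      by blast+
    moreover have "low_sum ?y1 D = low_sum i D" "low_sum ?y2 D = low_sum i D"
      if "far (4 * L) i D" for D
      by (rule low_sum_cong_far[OF that]; simp add: L)+
    then have "low_sum ?y1 ?w = low_sum i B + low_sum i C"
      "low_sum ?y2 ?w = exponent b + (low_sum i B + (exponent b' + low_sum i C))"
      using near' by (simp_all add: far abs_le_iff)
    ultimately have "exponent b + exponent b' = 0"
      by linarith
    then show ?thesis by (auto simp: exponent_def split: if_splits)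
  qed
  define \<rho> where "\<rho> = low_sum i B"
  define p where "p = nat (int i + \<rho>)"
  have "0 \<le> int i + \<rho>"
    unfolding \<rho>_def using index_plus_low_sum_nonneg[OF far(1)] len by (simp add: L)
  then have p: "real p = real i + of_int \<rho>"
    by (simp add: p_def)
  let ?B = "shift_above i (\<not> b) B"
  have far1: "far 1 i B" by (rule far_mono[OF far(1)]) (simp add: L)
  have "letter (i, b) + word_value B = word_value ?B + letter (p, b)"
    unfolding p_def \<rho>_def using len by (intro letter_push[OF far(1)]) (simp add: L)
  then have "word_value (?B @ (p, b) # (i', \<not> b) # C) = word_value []"
    using ev by (simp add: b' add.assoc) (simp add: add.assoc[symmetric])
  then have act: "fold letter_act (?B @ (p, b) # (i', \<not> b) # C) = fold letter_act []"
    by (rule fold_letter_act_cong)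
  have farB: "far (4 * L - 1) i ?B"
    using far(1) by (intro far_shift_above) (simp add: L)
  have \<rho>: "low_sum i ?B = \<rho>" "\<bar>\<rho>\<bar> \<le> d"
    using low_sum_shift_above[OF far1] abs_low_sum_le[of i B] len by (simp_all add: \<rho>_def)
  have pair: "letter_act (i', \<not> b) (letter_act (p, b) z) = z - \<rho> - low_sum i C"
    if z: "\<bar>z - real i\<bar> \<le> 2 * L" for z
  proof -
    let ?z = "letter_act (i', \<not> b) (letter_act (p, b) z)"
    have "fold letter_act ?B (z - \<rho>) = (z - \<rho>) + low_sum i ?B"
      using z \<rho> len by (intro fold_letter_act_far[OF farB]) (auto simp: L of_nat_diff)
    then have "fold letter_act ?B (z - \<rho>) = z" by (simp add: \<rho>)
    moreover have "fold letter_act C ?z = ?z + low_sum i C"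
    proof (rule fold_letter_act_far[OF far(2)])
      have "\<bar>letter_act x y - y\<bar> \<le> 1" for x y
        by (auto simp: letter_act_def Let_def abs_le_iff field_simps)
      from this[of "(p, b)" z] this[of "(i', \<not> b)" "letter_act (p, b) z"]
      have "\<bar>?z - z\<bar> \<le> 2" by linarith
      then show "real (length C + 1) + \<bar>?z - real i\<bar> \<le> real (4 * L)"
        using z len by (simp add: L)
    qed
    moreover have "fold letter_act (?B @ (p, b) # (i', \<not> b) # C) (z - \<rho>) = z - \<rho>"
      by (simp only: act) simp
    ultimately show ?thesis by simp
  qed
  have "i' = p"
  proof (rule ccontr)
    assume neq: "i' \<noteq> p"
    define a where "a = min (real i') (real p)"
    have a: "\<bar>a - real i\<bar> \<le> L" using near' p \<rho>(2) by (auto simp: a_def L)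
    have "a = a - \<rho> - low_sum i C"
      using pair[of a] a by (simp add: letter_act_def Let_def a_def)
    \<comment> \<open>Half a unit above \<open>a\<close>, the letter of smaller index moves the point and the other letter cannot undo this.\<close>
    moreover have "letter_act (i', \<not> b) (letter_act (p, b) (a + 1 / 2)) = a + 1 / 2 - \<rho> - low_sum i C"
      using a by (intro pair) (auto simp: L)
    ultimately have *: "letter_act (i', \<not> b) (letter_act (p, b) (a + 1 / 2)) = a + 1 / 2"
      by simp
    consider "i' + 1 \<le> p" | "p + 1 \<le> i'" using neq by linarith
    then show False
    proof cases
      case 1
      then have "a = real i'" "real i' + 1 \<le> real p" by (auto simp: a_def)
      with * show False by (cases b) (auto simp: letter_act_def Let_def)
    next
      case 2
      then have "a = real p" "real p + 1 \<le> real i'" by (auto simp: a_def)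
      with * show False by (cases b) (auto simp: letter_act_def Let_def)
    qed
  qed
  then show ?thesis
    using shift_above_inverse[OF far1, of "\<not> b"] low_sum_shift_above[OF far1, of "\<not> b"]
    by (simp add: insert_pair_def b' p_def \<rho>_def)
qed

section \<open>The number of trivial words\<close>

lemma set_shift_above_subset:
  "set w \<subseteq> {..<n} \<times> UNIV \<Longrightarrow> set (shift_above i up w) \<subseteq> {..<Suc n} \<times> UNIV"
proof (induction w)
  case (Cons x w)
  then show ?case by (cases x) auto
qed simp

text \<open>
  Up to clustered words, every trivial word of length \<open>2m + 2\<close> arises by \<open>insert_pair\<close> from a trivial
  word of length \<open>2m\<close>. The index bound of the shorter word is \<open>n + 1\<close> because the shift may raise an
  index by one.
\<close>

lemma card_trivial_words_upper:
  defines "L m \<equiv> 2 * (2 * m + 3)"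
  shows "card (trivial_words (2 * m + 2) n) \<le>
    (2 * (m * (6 * L m + 1))) ^ (2 * m + 2) * n ^ m
      + 2 * (2 * m + 1) * n * card (trivial_words (2 * m) (n + 1))"
proof -
  let ?L = "L m" and ?d = "2 * m + 2"
  define X where "X = {..2 * m} \<times> (UNIV :: bool set) \<times> {..<n} \<times> trivial_words (2 * m) (n + 1)"
  define f where "f = (\<lambda>(j, b, i, u). insert_pair j b i u)"
  have fin: "finite X" by (simp add: X_def)
  have "trivial_words ?d n \<subseteq> clustered_words ?d n m (6 * ?L) \<union> f ` X"
  proof
    fix w assume w: "w \<in> trivial_words ?d n"
    then have len: "length w = ?d" and sub: "set w \<subseteq> {..<n} \<times> UNIV" and ev: "word_value w = 0"
      by (auto simp: trivial_words_def)
    show "w \<in> clustered_words ?d n m (6 * ?L) \<union> f ` X"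
    proof (cases "w \<in> clustered_words ?d n m (6 * ?L)")
      case nc: False
      obtain i b v where wv: "w = (i, b) # v"
        using len by (cases w) auto
      \<comment> \<open>With isolation radius \<open>4L\<close>, the intervals that cover two neighbouring pairs have length \<open>2L + 4L\<close>.\<close>
      have two: "length (filter (\<lambda>x'. near e i (fst x')) w) = 2" if "?L \<le> e" "e \<le> 4 * ?L" for e
        using clustered_or_isolated_pairs[OF w _ that, of "(i, b)"] nc by (simp add: L_def wv)
      have "near e i i" for e by (simp add: near_def)
      then have one: "length (filter (\<lambda>x'. near e i (fst x')) v) = 1" if "?L \<le> e" "e \<le> 4 * ?L" for e
        using two[OF that] by (simp add: wv)
      then have "length (filter (\<lambda>x'. near (4 * ?L) i (fst x')) v) = Suc 0"
        by simp
      then obtain x where "filter (\<lambda>x'. near (4 * ?L) i (fst x')) v = [x]"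
        unfolding length_Suc_conv by blast
      then obtain B C where v: "v = B @ x # C"
        and B: "\<forall>y\<in>set B. \<not> near (4 * ?L) i (fst y)"
        and "[] = filter (\<lambda>x'. near (4 * ?L) i (fst x')) C"
        unfolding filter_eq_Cons_iff by blast
      then have C: "\<forall>y\<in>set C. \<not> near (4 * ?L) i (fst y)"
        using filter_empty_conv[of "\<lambda>x'. near (4 * ?L) i (fst x')" C] by simp
      obtain i' b' where x: "x = (i', b')" by (cases x)
      have weaken: "near ?L i k \<Longrightarrow> near (4 * ?L) i k" for k
        by (simp add: near_def)
      have "near ?L i i'"
      proof (rule ccontr)
        assume "\<not> ?thesis"
        then have "filter (\<lambda>x'. near ?L i (fst x')) v = []"
          using B C weaken by (auto simp: v x filter_empty_conv)
        then show False using one[of ?L] by simp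
      qed
      have far: "far (4 * ?L) i B" "far (4 * ?L) i C"
        using B C by (simp_all add: far_iff_not_near)
      define u where "u = shift_above i (\<not> b) B @ C"
      have lenBC: "length B + length C = 2 * m" using len by (simp add: wv v)
      have w_eq: "w = insert_pair (length B) b i u"
        unfolding wv v x u_def
        by (rule isolated_pair_is_inserted[where L = ?L and d = ?d])
           (use ev far \<open>near ?L i i'\<close> lenBC in \<open>simp_all add: wv v x L_def\<close>)
      have "far (4 * ?L - 1) i (shift_above i (\<not> b) B)"
        by (intro far_shift_above far_mono[OF far(1)]) (simp add: L_def)
      then have "far (length u + 2) i (shift_above i (\<not> b) B)"
        by (rule far_mono) (use lenBC in \<open>simp add: u_def L_def\<close>)
      moreover have "far (length u + 2) i C"
        by (rule far_mono[OF far(2)]) (use lenBC in \<open>simp add: u_def L_def\<close>)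
      ultimately have "far (length u + 2) i u"
        by (simp only: u_def far_append)
      then have "word_value u = 0"
        using word_value_insert_pair ev w_eq by metis
      moreover have "set u \<subseteq> {..<n + 1} \<times> UNIV"
        using sub set_shift_above_subset[of B n i "\<not> b"] by (fastforce simp: u_def wv v)
      ultimately have "u \<in> trivial_words (2 * m) (n + 1)"
        using lenBC by (simp add: trivial_words_def u_def)
      moreover have "length B \<le> 2 * m" "i < n"
        using lenBC sub by (auto simp: wv)
      ultimately have "w \<in> f ` X"
        unfolding X_def f_def w_eq by (intro image_eqI[of _ _ "(length B, b, i, u)"]) auto
      then show ?thesis by simp
    qed simp
  qed
  then have "card (trivial_words ?d n) \<le> card (clustered_words ?d n m (6 * ?L) \<union> f ` X)"
    using fin finite_clustered_words by (intro card_mono) auto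
  also have "\<dots> \<le> card (clustered_words ?d n m (6 * ?L)) + card (f ` X)"
    by (rule card_Un_le)
  also have "card (f ` X) \<le> card X"
    by (rule card_image_le[OF fin])
  also have "card X = 2 * (2 * m + 1) * n * card (trivial_words (2 * m) (n + 1))"
    by (simp add: X_def card_cartesian_product algebra_simps)
  finally show ?thesis
    using card_clustered_words_le[of ?d n m "6 * ?L"] by simp
qed

lemma append_Cons_eq_unique:
  assumes "xs @ x # ys = xs' @ x' # ys'" "P x" "P x'" "\<forall>y\<in>set xs. \<not> P y" "\<forall>y\<in>set xs'. \<not> P y"
  shows "xs = xs' \<and> ys = ys'"
proof -
  have "takeWhile (\<lambda>y. \<not> P y) (zs @ z # zs') = zs" if "P z" "\<forall>y\<in>set zs. \<not> P y" for z zs zs'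
    using that by (induction zs) auto
  from this[of x xs ys] this[of x' xs' ys'] assms have "xs = xs'" by simp
  with assms(1) show ?thesis by simp
qed

text \<open>
  The partner can be recognised in the long word: it is the only letter near the first one. All
  parameters can be read off from its position.
\<close>

lemma insert_pair_inject:
  assumes eq: "insert_pair j b i u = insert_pair j' b' i' u'"
    and len: "length u = d" "length u' = d" and j: "j \<le> d" "j' \<le> d"
    and far: "far (d + 2) (real i) u" "far (d + 2) (real i') u'"
  shows "j = j' \<and> b = b' \<and> i = i' \<and> u = u'"
proof -
  have i: "i = i'" and b: "b = b'"
    using eq by (simp_all add: insert_pair_def)
  have inserted: "near d i (nat (int i + low_sum i (take k v)))"
      "\<forall>x\<in>set (shift_above i b (take k v)). \<not> near d i (fst x)"
      "shift_above i (\<not> b) (shift_above i b (take k v)) = take k v"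
    if v: "length v = d" "far (d + 2) (real i) v" for k v
  proof -
    have far_k: "far (d + 2) i (take k v)" using v(2) by (rule far_take)
    have "length (take k v) \<le> d" using v(1) by simp
    then show "near d i (nat (int i + low_sum i (take k v)))"
      using abs_low_sum_le[of i "take k v"] unfolding near_def by linarith
    have "far (d + 1) i (shift_above i b (take k v))"
      using far_k by (intro far_shift_above) simp
    then have "far d i (shift_above i b (take k v))"
      by (rule far_mono) simp
    then show "\<forall>x\<in>set (shift_above i b (take k v)). \<not> near d i (fst x)"
      by (simp add: far_iff_not_near)
    show "shift_above i (\<not> b) (shift_above i b (take k v)) = take k v"
      by (rule shift_above_inverse[OF far_mono[OF far_k]]) simp
  qed
  note ins = inserted[OF len(1) far(1), of j] inserted[OF len(2) far(2)[folded i], of j']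
  have "shift_above i b (take j u) @ (nat (int i + low_sum i (take j u)), \<not> b) # drop j u =
      shift_above i b (take j' u') @ (nat (int i + low_sum i (take j' u')), \<not> b) # drop j' u'"
    using eq by (simp add: insert_pair_def i b)
  then have *: "shift_above i b (take j u) = shift_above i b (take j' u') \<and> drop j u = drop j' u'"
    by (rule append_Cons_eq_unique[where P = "\<lambda>x. near d i (fst x)", OF _ _ _ ins(2) ins(5)])
       (simp_all only: fst_conv ins(1,4))
  then have take: "take j u = take j' u'"
    using ins(3,6) by metis
  have "u = u'"
    using append_take_drop_id[of j u] append_take_drop_id[of j' u'] take conjunct2[OF *] by simp
  moreover have "j = j'"
    using arg_cong[OF take, of length] by (simp only: length_take len min.absorb2[OF j(1)] min.absorb2[OF j(2)])
  ultimately show ?thesis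
    using i b by simp
qed

text \<open>
  Insertion is injective on the words \<open>u\<close> and indices \<open>i\<close> that are far from each other. For given
  \<open>u\<close> only the boundedly many \<open>i\<close> near one of the \<open>2m\<close> letters are excluded. The index bound
  grows by \<open>2m + 1\<close> to make room for the shifted indices, which does not affect the asymptotics.
\<close>

lemma card_trivial_words_lower:
  defines "K m \<equiv> 2 * m * (2 * (2 * m + 2) + 1)"
  shows "2 * (2 * m + 1) * (n - K m) * card (trivial_words (2 * m) n)
    \<le> card (trivial_words (2 * m + 2) (n + 2 * m + 1))"
proof -
  let ?F = "2 * m + 2"
  define Y where "Y = (SIGMA u:trivial_words (2 * m) n. {i\<in>{..<n}. far ?F (real i) u})"
  define X where "X = {..2 * m} \<times> (UNIV :: bool set) \<times> Y"
  define f where "f = (\<lambda>(j, b, u, i). insert_pair j b i u)"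
  have fin: "finite Y" unfolding Y_def by (intro finite_SigmaI) auto
  have "inj_on f X"
  proof (rule inj_onI)
    fix x x' assume mem: "x \<in> X" "x' \<in> X" and eq: "f x = f x'"
    obtain j b u i j' b' u' i' where x: "x = (j, b, u, i)" "x' = (j', b', u', i')"
      by (metis prod.exhaust)
    show "x = x'"
      using insert_pair_inject[of j b i u j' b' i' u' "2 * m"] mem eq
      by (simp add: x f_def X_def Y_def trivial_words_def)
  qed
  have sub: "f ` X \<subseteq> trivial_words (2 * m + 2) (n + 2 * m + 1)"
  proof (rule image_subsetI)
    fix x assume "x \<in> X"
    then obtain j b u i where x: "x = (j, b, u, i)" and j: "j \<le> 2 * m" and i: "i < n"
      and u: "length u = 2 * m" "set u \<subseteq> {..<n} \<times> UNIV" "word_value u = 0" and far: "far ?F (real i) u"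
      by (auto simp: X_def Y_def trivial_words_def)
    have "word_value (insert_pair j b i u) = 0"
      using far u by (subst word_value_insert_pair) simp_all
    moreover have "set (insert_pair j b i u) \<subseteq> {..<n + 2 * m + 1} \<times> UNIV"
    proof -
      have "\<bar>low_sum i (take j u)\<bar> \<le> 2 * int m"
        using abs_low_sum_le[of i "take j u"] u(1) by simp
      then have "nat (int i + low_sum i (take j u)) < n + 2 * m + 1"
        using i by linarith
      moreover have "{..<n} \<times> UNIV \<subseteq> {..<n + 2 * m + 1} \<times> (UNIV :: bool set)"
        and "{..<Suc n} \<times> UNIV \<subseteq> {..<n + 2 * m + 1} \<times> (UNIV :: bool set)"
        by auto
      then have "set (drop j u) \<subseteq> {..<n + 2 * m + 1} \<times> UNIV"
        and "set (shift_above i b (take j u)) \<subseteq> {..<n + 2 * m + 1} \<times> UNIV"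
        using order_trans[OF set_drop_subset u(2)]
          set_shift_above_subset[OF order_trans[OF set_take_subset u(2)]] order_trans by metis+
      ultimately show ?thesis
        using i by (simp add: insert_pair_def)
    qed
    moreover have "length (insert_pair j b i u) = 2 * m + 2"
      using u(1) j by (simp add: insert_pair_def)
    ultimately show "f x \<in> trivial_words (2 * m + 2) (n + 2 * m + 1)"
      by (simp add: x f_def trivial_words_def)
  qed
  have far_card: "n - K m \<le> card {i\<in>{..<n}. far ?F (real i) u}" if u: "u \<in> trivial_words (2 * m) n" for u
  proof -
    let ?N = "\<Union>x\<in>set u. {fst x - ?F..fst x + ?F}"
    have "{..<n} - ?N \<subseteq> {i\<in>{..<n}. far ?F (real i) u}"
      by (auto simp: far_iff_not_near near_def)
    then have "card ({..<n} - ?N) \<le> card {i\<in>{..<n}. far ?F (real i) u}"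
      by (intro card_mono) auto
    moreover have "card {..<n} - card ?N \<le> card ({..<n} - ?N)"
      by (rule diff_card_le_card_Diff) simp
    moreover have "card ?N \<le> K m"
    proof -
      have "card ?N \<le> (\<Sum>x\<in>set u. card {fst x - ?F..fst x + ?F})"
        by (rule card_UN_le) simp
      also have "\<dots> \<le> (\<Sum>x\<in>set u. 2 * ?F + 1)"
        by (intro sum_mono) auto
      also have "\<dots> = card (set u) * (2 * ?F + 1)" by simp
      also have "\<dots> \<le> K m"
        using card_length[of u] u unfolding K_def
        by (intro mult_le_mono1) (simp add: trivial_words_def)
      finally show ?thesis .
    qed
    ultimately show ?thesis by simp
  qed
  have "2 * (2 * m + 1) * ((n - K m) * card (trivial_words (2 * m) n)) \<le> 2 * (2 * m + 1) * card Y"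
  proof (rule mult_le_mono2)
    have "(n - K m) * card (trivial_words (2 * m) n) = (\<Sum>u\<in>trivial_words (2 * m) n. n - K m)"
      by simp
    also have "\<dots> \<le> (\<Sum>u\<in>trivial_words (2 * m) n. card {i\<in>{..<n}. far ?F (real i) u})"
      by (intro sum_mono far_card)
    also have "\<dots> = card Y"
      unfolding Y_def by (simp add: card_SigmaI)
    finally show "(n - K m) * card (trivial_words (2 * m) n) \<le> card Y" .
  qed
  also have "2 * (2 * m + 1) * card Y = card X"
    by (simp add: X_def card_cartesian_product)
  also have "\<dots> = card (f ` X)"
    by (rule card_image[symmetric, OF \<open>inj_on f X\<close>])
  also have "\<dots> \<le> card (trivial_words (2 * m + 2) (n + 2 * m + 1))"
    by (rule card_mono[OF _ sub]) simp
  finally show ?thesis by (simp only: mult.assoc)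
qed

text \<open>
  Above all indices there is a gap, and the exponent sum of an odd number of letters is not zero.
\<close>

lemma trivial_words_odd:
  assumes "odd d"
  shows "trivial_words d n = {}"
proof -
  have False if w: "w \<in> trivial_words d n" for w
  proof -
    define y where "y = real n + d + 2"
    have w': "length w = d" "set w \<subseteq> {..<n} \<times> UNIV" "word_value w = 0"
      using w by (auto simp: trivial_words_def)
    have small: "real (fst x) < n" if "x \<in> set w" for x
    proof -
      from w'(2) that have "x \<in> {..<n} \<times> UNIV" by (rule subsetD)
      then show ?thesis by (cases x) simp
    qed
    have "far (length w + 1) y w"
      unfolding far_def
    proof
      fix x assume "x \<in> set w"
      from small[OF this] show "real (fst x) + real (length w + 1) < y \<or>
          y + real (length w + 1) < real (fst x)"
        by (simp add: y_def w'(1))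
    qed
    then have "even (length (filter (\<lambda>x. real (fst x) < y) w))"
      using even_low_sum[of y w] low_sum_gap[OF w'(3)] by simp
    moreover have "filter (\<lambda>x. real (fst x) < y) w = w"
    proof (rule filter_True, rule ballI)
      fix x assume "x \<in> set w"
      from small[OF this] show "real (fst x) < y" by (simp add: y_def)
    qed
    ultimately show False using assms w'(1) by simp
  qed
  then show ?thesis by blast
qed

text \<open>
  With \<open>N m n\<close> the number of trivial words of length \<open>2m\<close>, the two bounds say
  \<open>N (m + 1) n = 2 (2m + 1) n N m n + O(n\<^sup>m)\<close> up to bounded shifts of \<open>n\<close>. After division by
  \<open>(2n)\<^bsup>m + 1\<^esup>\<close> this is the recursion \<open>c (m + 1) = (2m + 1) c m\<close> of the double factorials
  \<open>c m = (2m)! / (2\<^sup>m m!)\<close>.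
\<close>

lemma trivial_words_even_asymptotics:
  "(\<lambda>n. real (card (trivial_words (2 * m) n)) / (2 * real n) ^ m) \<longlonglongrightarrow> fact (2 * m) / (2 ^ m * fact m)"
proof (induction m)
  case 0
  have "trivial_words 0 n = {[]}" for n by (auto simp: trivial_words_def)
  then show ?case by simp
next
  case (Suc m)
  let ?N = "\<lambda>m n. real (card (trivial_words (2 * m) n))"
  define r where "r m n = ?N m n / (2 * real n) ^ m" for m n
  define c :: "nat \<Rightarrow> real" where "c m = fact (2 * m) / (2 ^ m * fact m)" for m
  obtain C where C: "\<And>n. card (trivial_words (2 * m + 2) n) \<le>
      C * n ^ m + 2 * (2 * m + 1) * n * card (trivial_words (2 * m) (n + 1))"
    using card_trivial_words_upper by blast
  obtain K where K: "\<And>n. 2 * (2 * m + 1) * (n - K) * card (trivial_words (2 * m) n)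
      \<le> card (trivial_words (2 * m + 2) (n + 2 * m + 1))"
    using card_trivial_words_lower by blast
  have N_eq: "?N m n = r m n * (2 * real n) ^ m" if "n > 0" for n
    using that by (simp add: r_def)
  have c_Suc: "c (Suc m) = (2 * real m + 1) * c m"
  proof -
    have "c (Suc m) = (2 * (real m + 1)) * ((2 * real m + 1) * fact (2 * m)) /
        ((2 * (real m + 1)) * (2 ^ m * fact m))"
      by (simp add: c_def algebra_simps)
    also have "\<dots> = (2 * real m + 1) * fact (2 * m) / (2 ^ m * fact m)"
      by (rule mult_divide_mult_cancel_left) simp
    finally show ?thesis by (simp add: c_def)
  qed
  have lim': "r m \<longlonglongrightarrow> c m"
    using Suc unfolding r_def c_def .
  then have lim: "(\<lambda>n. r m (n + 1)) \<longlonglongrightarrow> c m"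
    by (rule LIMSEQ_ignore_initial_segment)
  define up where "up n = real C / 2 ^ (m + 1) * (1 / real n) +
    (2 * real m + 1) * r m (n + 1) * (1 + 1 / real n) ^ m" for n
  define lo where "lo n = (2 * real m + 1) * r m n * ((real n - real K) / real n) *
    (real n / real (n + (2 * m + 1))) ^ (m + 1)" for n
  have up: "r (Suc m) n \<le> up n" if n: "n > 0" for n
  proof -
    have "?N (Suc m) n \<le> real (C * n ^ m + 2 * (2 * m + 1) * n * card (trivial_words (2 * m) (n + 1)))"
      using C[of n] by (simp only: of_nat_le_iff) simp
    also have "\<dots> = C * real n ^ m + 2 * (2 * real m + 1) * n * (r m (n + 1) * (2 * real (n + 1)) ^ m)"
    proof -
      have "?N m (n + 1) = r m (n + 1) * (2 * real (n + 1)) ^ m"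
        by (rule N_eq) simp
      then show ?thesis
        by (simp only: of_nat_add of_nat_mult of_nat_power of_nat_numeral of_nat_1)
    qed
    finally have "r (Suc m) n \<le> (C * real n ^ m + 2 * (2 * real m + 1) * n * (r m (n + 1) * (2 * real (n + 1)) ^ m))
        / (2 * real n) ^ Suc m"
      unfolding r_def by (rule divide_right_mono) simp
    also have "\<dots> = up n"
    proof -
      have "real C * x ^ m / (2 * x) ^ Suc m = real C / 2 ^ (m + 1) * (1 / x)"
        and "2 * a * x * (R * (2 * (x + 1)) ^ m) / (2 * x) ^ Suc m = a * R * (1 + 1 / x) ^ m"
        if "x > 0" for x a R :: real
      proof -
        show "real C * x ^ m / (2 * x) ^ Suc m = real C / 2 ^ (m + 1) * (1 / x)"
          using that by (simp add: power_mult_distrib)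
        have "1 + 1 / x = 2 * (x + 1) / (2 * x)" using that by (simp add: field_simps)
        then have "(1 + 1 / x) ^ m = (2 * (x + 1)) ^ m / (2 * x) ^ m"
          by (simp only: power_divide)
        then show "2 * a * x * (R * (2 * (x + 1)) ^ m) / (2 * x) ^ Suc m = a * R * (1 + 1 / x) ^ m"
          using that by simp
      qed
      from this[of "real n"] show ?thesis
        using n unfolding up_def add_divide_distrib by (simp only: of_nat_0_less_iff of_nat_add of_nat_1)
    qed
    finally show ?thesis .
  qed
  have lo: "lo n \<le> r (Suc m) (n + (2 * m + 1))" if n: "n > 0" "n \<ge> K" for n
  proof -
    have "2 * (2 * real m + 1) * (real n - real K) * (r m n * (2 * real n) ^ m) =
        real (2 * (2 * m + 1) * (n - K) * card (trivial_words (2 * m) n))"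
      by (simp only: of_nat_mult of_nat_add of_nat_numeral of_nat_1 of_nat_diff[OF n(2)] N_eq[OF n(1)])
    also have "\<dots> \<le> ?N (Suc m) (n + (2 * m + 1))"
      using K[of n] by (simp only: of_nat_le_iff) (simp add: add.assoc)
    finally have "2 * (2 * real m + 1) * (real n - real K) * (r m n * (2 * real n) ^ m)
        / (2 * real (n + (2 * m + 1))) ^ Suc m \<le> r (Suc m) (n + (2 * m + 1))"
      unfolding r_def by (rule divide_right_mono) simp
    moreover have "lo n = 2 * (2 * real m + 1) * (real n - real K) * (r m n * (2 * real n) ^ m)
        / (2 * real (n + (2 * m + 1))) ^ Suc m"
    proof -
      have "a * R * ((x - k) / x) * (x / y) ^ (m + 1) = 2 * a * (x - k) * (R * (2 * x) ^ m) / (2 * y) ^ Suc m"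
        if "x > 0" for x y a k R :: real
      proof -
        have "(x / y) ^ (m + 1) = (2 * x / (2 * y)) ^ (m + 1)" by simp
        also have "\<dots> = (2 * x) ^ (m + 1) / (2 * y) ^ (m + 1)" by (rule power_divide)
        finally show ?thesis using that by simp
      qed
      then show ?thesis using n by (simp only: lo_def of_nat_0_less_iff)
    qed
    ultimately show ?thesis by simp
  qed
  have "(\<lambda>n. 1 / real n) \<longlonglongrightarrow> 0" by (rule lim_1_over_n)
  then have "up \<longlonglongrightarrow> real C / 2 ^ (m + 1) * 0 + (2 * real m + 1) * c m * (1 + 0) ^ m"
    unfolding up_def by (intro tendsto_intros lim)
  then have up_lim: "up \<longlonglongrightarrow> c (Suc m)" by (simp add: c_Suc)
  have "(\<lambda>n. (real n - real K) / real n) \<longlonglongrightarrow> 1"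
    and "(\<lambda>n. real n / real (n + (2 * m + 1))) \<longlonglongrightarrow> 1"
    by real_asymp+
  then have "lo \<longlonglongrightarrow> (2 * real m + 1) * c m * 1 * 1 ^ (m + 1)"
    unfolding lo_def by (intro tendsto_intros lim')
  then have lo_lim: "lo \<longlonglongrightarrow> c (Suc m)" by (simp add: c_Suc)
  have "(\<lambda>n. r (Suc m) (n + (2 * m + 1))) \<longlonglongrightarrow> c (Suc m)"
  proof (rule tendsto_sandwich)
    show "eventually (\<lambda>n. lo n \<le> r (Suc m) (n + (2 * m + 1))) sequentially"
      using eventually_gt_at_top[of 0] eventually_ge_at_top[of K] by eventually_elim (rule lo)
    show "eventually (\<lambda>n. r (Suc m) (n + (2 * m + 1)) \<le> up (n + (2 * m + 1))) sequentially"
      by (intro always_eventually allI up) simp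
    show "(\<lambda>n. up (n + (2 * m + 1))) \<longlonglongrightarrow> c (Suc m)"
      by (rule LIMSEQ_ignore_initial_segment[OF up_lim])
  qed (rule lo_lim)
  then have "r (Suc m) \<longlonglongrightarrow> c (Suc m)"
    by (rule LIMSEQ_offset)
  then show ?case unfolding r_def c_def .
qed

section \<open>Limits of measures from limits of moments\<close>

text \<open>
  The Taylor polynomial of even order \<open>2k\<close> approximates the characteristic function of each \<open>M n\<close> up to
  twice \<open>\<bar>t\<bar>\<^bsup>2k\<^esup> / (2k)!\<close> times its moment of order \<open>2k\<close>. These moments converge, so the error bound for
  the limit \<open>N\<close> controls the errors for almost all \<open>M n\<close> as well.
\<close>

lemma char_tendsto_of_moments:
  assumes M: "\<And>n. real_distribution (M n)" "real_distribution N"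
    and int: "\<And>n k. integrable (M n) (\<lambda>x. x ^ k)" "\<And>k. integrable N (\<lambda>x. x ^ k)"
    and lim: "\<And>k. (\<lambda>n. \<integral>x. x ^ k \<partial>M n) \<longlonglongrightarrow> (\<integral>x. x ^ k \<partial>N)"
    and small: "(\<lambda>k. \<bar>t\<bar> ^ (2 * k) / fact (2 * k) * (\<integral>x. x ^ (2 * k) \<partial>N)) \<longlonglongrightarrow> 0"
  shows "(\<lambda>n. char (M n) t) \<longlonglongrightarrow> char N t"
proof (rule LIMSEQ_I)
  fix e :: real assume e: "e > 0"
  let ?m = "\<lambda>n k. \<integral>x. x ^ k \<partial>M n" and ?m' = "\<lambda>k. \<integral>x. x ^ k \<partial>N"
  obtain k where k: "\<bar>t\<bar> ^ (2 * k) / fact (2 * k) * ?m' (2 * k) < e / 8"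
    using LIMSEQ_D[OF small, of "e / 8"] e by (force simp: abs_less_iff)
  define T where "T n = (\<Sum>j\<le>2 * k. (\<i> * t) ^ j / fact j * ?m n j)" for n
  define T' where "T' = (\<Sum>j\<le>2 * k. (\<i> * t) ^ j / fact j * ?m' j)"
  have TT': "T \<longlonglongrightarrow> T'"
    unfolding T_def T'_def by (intro tendsto_intros lim)
  have bound: "cmod (char (M n) t - T n) \<le> 2 * (\<bar>t\<bar> ^ (2 * k) / fact (2 * k) * ?m n (2 * k))" for n
    using real_distribution.char_approx1[OF M(1), of "2 * k" n t, OF int(1)]
    by (simp add: T_def power_even_abs power_mult_distrib[symmetric])
  have bound': "cmod (char N t - T') \<le> 2 * (\<bar>t\<bar> ^ (2 * k) / fact (2 * k) * ?m' (2 * k))"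
    using real_distribution.char_approx1[OF M(2), of "2 * k" t, OF int(2)]
    by (simp add: T'_def power_even_abs)
  have "(\<lambda>n. \<bar>t\<bar> ^ (2 * k) / fact (2 * k) * ?m n (2 * k))
      \<longlonglongrightarrow> \<bar>t\<bar> ^ (2 * k) / fact (2 * k) * ?m' (2 * k)"
    by (intro tendsto_intros lim)
  then have "eventually (\<lambda>n. \<bar>t\<bar> ^ (2 * k) / fact (2 * k) * ?m n (2 * k) < e / 8) sequentially"
    using k by (rule order_tendstoD)
  moreover have "eventually (\<lambda>n. dist (T n) T' < e / 4) sequentially"
    using TT' e by (intro tendstoD) auto
  ultimately have "eventually (\<lambda>n. cmod (char (M n) t - char N t) < e) sequentially"
  proof eventually_elim
    case (elim n)
    have "cmod (char (M n) t - char N t) \<le>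
        cmod (char (M n) t - T n) + cmod (T n - T') + cmod (char N t - T')"
      by (rule order_trans[OF norm_triangle_sub[of _ "char (M n) t - T n"]])
         (use norm_triangle_ineq4[of "T n - T'" "char N t - T'"] in \<open>simp add: algebra_simps\<close>)
    then show ?case
      using bound[of n] bound' k elim e unfolding dist_norm by linarith
  qed
  then show "\<exists>n0. \<forall>n\<ge>n0. cmod (char (M n) t - char N t) < e"
    by (simp add: eventually_sequentially)
qed

lemma is_law_AE_bounded:
  assumes "is_law a M"
  obtains r where "r > 0" "AE x in M. \<bar>x\<bar> \<le> r"
proof -
  interpret prob_space M using assms by (simp add: is_law_def)
  from assms obtain K where K: "compact K" "prob K = 1" "sets M = sets borel"
    by (auto simp: is_law_def)
  from K(1) obtain r where r: "r > 0" "\<And>x. x \<in> K \<Longrightarrow> \<bar>x\<bar> \<le> r"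
    by (auto simp: compact_eq_bounded_closed bounded_pos)
  have "K \<in> events"
    using K by (simp add: borel_closed compact_imp_closed)
  then have "AE x in M. x \<in> K"
    using K(2) by (simp add: prob_eq_1)
  then have "AE x in M. \<bar>x\<bar> \<le> r"
    by eventually_elim (rule r(2))
  with r(1) show ?thesis by (rule that)
qed

lemma is_law_real_distribution: "is_law a M \<Longrightarrow> real_distribution M"
  using sets_eq_imp_space_eq[of M borel]
  by (auto simp: is_law_def real_distribution_def real_distribution_axioms_def)

lemma integrable_power_of_AE_bounded:
  fixes M :: "real measure"
  assumes "real_distribution M" "AE x in M. \<bar>x\<bar> \<le> r"
  shows "integrable M (\<lambda>x. x ^ k)"
proof -
  interpret real_distribution M by fact
  show ?thesis
  proof (rule integrable_const_bound)
    show "AE x in M. norm (x ^ k) \<le> r ^ k"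
      using assms(2) by eventually_elim (simp add: power_abs power_mono)
  qed simp
qed

lemma power_div_fact_tendsto_0: "(\<lambda>k. (c::real) ^ k / fact k) \<longlonglongrightarrow> 0"
  using summable_LIMSEQ_zero[OF summable_exp[of c]] by (simp add: field_simps)

text \<open>
  The case of a constant sequence in \<open>char_tendsto_of_moments\<close>; the moments of a bounded distribution grow
  at most geometrically.
\<close>

lemma eq_of_moments_eq:
  assumes M: "real_distribution M" "AE x in M. \<bar>x\<bar> \<le> r"
    and N: "real_distribution N" "AE x in N. \<bar>x\<bar> \<le> s"
    and eq: "\<And>k. (\<integral>x. x ^ k \<partial>M) = (\<integral>x. x ^ k \<partial>N)"
  shows "M = N"
proof (rule Levy_uniqueness[OF M(1) N(1)], rule ext)
  fix t
  interpret N: real_distribution N by (rule N(1))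
  note int = integrable_power_of_AE_bounded[OF M] integrable_power_of_AE_bounded[OF N]
  have "(\<lambda>n::nat. char M t) \<longlonglongrightarrow> char N t"
  proof (rule char_tendsto_of_moments)
    have "(\<lambda>k. (\<bar>t\<bar> * s) ^ (2 * k) / fact (2 * k)) \<longlonglongrightarrow> 0"
      using LIMSEQ_subseq_LIMSEQ[OF power_div_fact_tendsto_0, of "\<lambda>k. 2 * k" "\<bar>t\<bar> * s"]
      by (simp add: strict_mono_def o_def)
    then show "(\<lambda>k. \<bar>t\<bar> ^ (2 * k) / fact (2 * k) * (\<integral>x. x ^ (2 * k) \<partial>N)) \<longlonglongrightarrow> 0"
    proof (rule Lim_null_comparison[rotated], intro always_eventually allI)
      fix k
      have "(\<integral>x. x ^ (2 * k) \<partial>N) \<le> (\<integral>x. s ^ (2 * k) \<partial>N)"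
      proof (rule integral_mono_AE)
        show "AE x in N. x ^ (2 * k) \<le> s ^ (2 * k)"
          using N(2)
        proof eventually_elim
          case (elim x)
          then have "\<bar>x\<bar> ^ (2 * k) \<le> s ^ (2 * k)" by (intro power_mono) auto
          then show ?case by (simp add: power_even_abs)
        qed
      qed (auto intro: int)
      then have "\<bar>t\<bar> ^ (2 * k) / fact (2 * k) * (\<integral>x. x ^ (2 * k) \<partial>N)
          \<le> \<bar>t\<bar> ^ (2 * k) / fact (2 * k) * s ^ (2 * k)"
        using N.prob_space by (intro mult_left_mono) simp_all
      moreover have "0 \<le> (\<integral>x. x ^ (2 * k) \<partial>N)"
        by (intro integral_nonneg_AE) (auto simp: zero_le_even_power)
      ultimately show "norm (\<bar>t\<bar> ^ (2 * k) / fact (2 * k) * (\<integral>x. x ^ (2 * k) \<partial>N))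
          \<le> (\<bar>t\<bar> * s) ^ (2 * k) / fact (2 * k)"
        by (simp add: power_mult_distrib abs_mult)
    qed
  qed (auto intro: M N int simp: eq)
  then show "char M t = char N t"
    by (simp add: LIMSEQ_const_iff)
qed

lemma is_law_unique:
  assumes "is_law a M" "is_law a N"
  shows "M = N"
proof -
  interpret M: prob_space M using assms by (simp add: is_law_def)
  interpret N: prob_space N using assms by (simp add: is_law_def)
  obtain r s where "AE x in M. \<bar>x\<bar> \<le> r" "AE x in N. \<bar>x\<bar> \<le> s"
    using is_law_AE_bounded assms by metis
  moreover have "(\<integral>x. x ^ k \<partial>M) = (\<integral>x. x ^ k \<partial>N)" for k
  proof (cases "k = 0")
    case True
    then show ?thesis by (simp add: M.prob_space N.prob_space)
  next
    case False
    with assms have "complex_of_real (\<integral>x. x ^ k \<partial>M) = complex_of_real (\<integral>x. x ^ k \<partial>N)"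
      by (simp add: is_law_def)
    then show ?thesis by (simp only: of_real_eq_iff)
  qed
  ultimately show ?thesis
    using assms is_law_real_distribution eq_of_moments_eq by metis
qed

lemma std_normal_moments:
  "(\<integral>x. x ^ (2 * k) \<partial>std_normal_distribution) = fact (2 * k) / (2 ^ k * fact k)"
  "(\<integral>x. x ^ (2 * k + 1) \<partial>std_normal_distribution) = 0"
  using std_normal_distribution_even_moments[of k] integral_std_normal_distribution_moment_odd[of "2 * k + 1"]
  by auto

lemma weak_conv_std_normal_of_moments:
  assumes M: "\<And>n. real_distribution (M n)" "\<And>n k. integrable (M n) (\<lambda>x. x ^ k)"
    and lim: "\<And>k. (\<lambda>n. \<integral>x. x ^ k \<partial>M n) \<longlonglongrightarrow> (\<integral>x. x ^ k \<partial>std_normal_distribution)"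
  shows "weak_conv_m M std_normal_distribution"
proof (rule levy_continuity)
  fix t
  show "(\<lambda>n. char (M n) t) \<longlonglongrightarrow> char std_normal_distribution t"
  proof (rule char_tendsto_of_moments)
    have "\<bar>t\<bar> ^ (2 * k) / fact (2 * k) * (\<integral>x. x ^ (2 * k) \<partial>std_normal_distribution)
        = (t\<^sup>2 / 2) ^ k / fact k" for k
      unfolding std_normal_moments by (simp add: power_mult power_divide)
    then show "(\<lambda>k. \<bar>t\<bar> ^ (2 * k) / fact (2 * k) *
        (\<integral>x. x ^ (2 * k) \<partial>std_normal_distribution)) \<longlonglongrightarrow> 0"
      using power_div_fact_tendsto_0[of "t\<^sup>2 / 2"] by simp
  qed (auto intro: M lim real_dist_normal_dist integrable_std_normal_distribution_moment)
qed (auto intro: M real_dist_normal_dist)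

section \<open>Hausdorff's moment problem\<close>

text \<open>
  For \<open>p = q = 0\<close> this says that the weights \<open>(N choose j) b j (N - j)\<close> form a probability distribution
  if \<open>b\<close> is nonnegative with \<open>b 0 0 = 1\<close>. The model is \<open>b k l = \<integral> x\<^sup>k (1 - x)\<^sup>l\<close>, for which
  it is the binomial theorem.
\<close>

lemma pascal_array_sum:
  fixes b :: "nat \<Rightarrow> nat \<Rightarrow> real"
  assumes pascal: "\<And>k l. b k l = b (Suc k) l + b k (Suc l)"
  shows "(\<Sum>j\<le>N. real (N choose j) * b (p + j) (q + N - j)) = b p q"
proof (induction N arbitrary: p q)
  case 0
  show ?case by simp
next
  case (Suc N)
  have choose: "(\<Sum>j\<le>Suc N. real (Suc N choose j) * f j) =
      (\<Sum>j\<le>N. real (N choose j) * f (Suc j)) + (\<Sum>j\<le>N. real (N choose j) * f j)" for f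
  proof -
    have "(\<Sum>j\<le>N. real (N choose j) * f j) = (\<Sum>j\<le>Suc N. real (N choose j) * f j)"
      by simp
    also have "\<dots> = f 0 + (\<Sum>j\<le>N. real (N choose Suc j) * f (Suc j))"
      by (subst sum.atMost_Suc_shift) simp
    finally show ?thesis
      by (subst sum.atMost_Suc_shift) (simp add: sum.distrib algebra_simps)
  qed
  have "(\<Sum>j\<le>N. real (N choose j) * b (p + Suc j) (q + Suc N - Suc j)) = b (Suc p) q"
    using Suc.IH[of "Suc p" q] by simp
  moreover have "(\<Sum>j\<le>N. real (N choose j) * b (p + j) (q + Suc N - j)) = b p (Suc q)"
    using Suc.IH[of p "Suc q"] by simp
  ultimately show ?case
    unfolding choose using pascal[of p q] by simp
qed

lemma pascal_array_factorial_moment: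
  fixes b :: "nat \<Rightarrow> nat \<Rightarrow> real"
  assumes pascal: "\<And>k l. b k l = b (Suc k) l + b k (Suc l)" and "d \<le> N"
  shows "(\<Sum>j\<le>N. real (N choose j) * b j (N - j) * real (j choose d)) = real (N choose d) * b d 0"
proof -
  let ?f = "\<lambda>j. real (N choose j) * b j (N - j) * real (j choose d)"
  have "(\<Sum>j\<le>N. ?f j) = (\<Sum>j\<in>{d..N}. ?f j)"
    by (rule sum.mono_neutral_right) (auto simp: binomial_eq_0 not_le)
  also have "\<dots> = (\<Sum>i\<le>N - d. ?f (d + i))"
    using \<open>d \<le> N\<close>
    by (intro sum.reindex_bij_witness[where i = "\<lambda>i. d + i" and j = "\<lambda>j. j - d"]) auto
  also have "\<dots> = (\<Sum>i\<le>N - d. real (N choose d) * (real (N - d choose i) * b (d + i) (0 + (N - d) - i)))"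
  proof (rule sum.cong)
    fix i assume i: "i \<in> {..N - d}"
    then have "(N choose (d + i)) * ((d + i) choose d) = (N choose d) * (N - d choose i)"
      using choose_mult[of d "d + i" N] \<open>d \<le> N\<close> by simp
    then have "real (N choose (d + i)) * real ((d + i) choose d) = real (N choose d) * real (N - d choose i)"
      by (metis of_nat_mult)
    then show "?f (d + i) = real (N choose d) * (real (N - d choose i) * b (d + i) (0 + (N - d) - i))"
      by (simp add: algebra_simps)
  qed simp
  also have "\<dots> = real (N choose d) * b d 0"
    unfolding sum_distrib_left[symmetric] using pascal_array_sum[where b = b, OF pascal, where N = "N - d" and p = d and q = 0]
    by simp
  finally show ?thesis .
qed

text \<open>
  Both terms are products of \<open>d\<close> factors of absolute value at most \<open>1\<close>, namely \<open>j / N\<close> and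
  \<open>(j - i) / N\<close> for \<open>i < d\<close>, so their difference is at most the sum of the differences of the factors.
\<close>

lemma power_minus_falling_factorial_le:
  assumes "j \<le> N" "d \<le> N"
  shows "\<bar>(real j / real N) ^ d - fact d / real N ^ d * real (j choose d)\<bar> \<le> (real d)\<^sup>2 / real N"
proof -
  have "fact d * real (j choose d) = (\<Prod>i<d. real j - real i)"
    by (simp add: binomial_gbinomial gbinomial_prod_rev atLeast0LessThan)
  then have "fact d / real N ^ d * real (j choose d) = (\<Prod>i<d. (real j - real i) / real N)"
    by (simp add: prod_dividef)
  moreover have "(real j / real N) ^ d = (\<Prod>i<d. real j / real N)"
    by simp
  moreover have "norm ((\<Prod>i<d. real j / real N) - (\<Prod>i<d. (real j - real i) / real N))
      \<le> (\<Sum>i<d. norm (real j / real N - (real j - real i) / real N))"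
    using assms by (intro norm_prod_diff) (auto simp: divide_simps abs_le_iff)
  moreover have "(\<Sum>i<d. norm (real j / real N - (real j - real i) / real N)) \<le> (\<Sum>i<d. real d / real N)"
    by (intro sum_mono) (simp add: diff_divide_distrib divide_right_mono)
  ultimately show ?thesis
    by (simp add: power2_eq_square)
qed

text \<open>
  The factorial moments are known exactly, and ordinary moments differ from them by \<open>O(1 / N)\<close>.
\<close>

lemma pascal_array_moment:
  fixes b :: "nat \<Rightarrow> nat \<Rightarrow> real"
  assumes pascal: "\<And>k l. b k l = b (Suc k) l + b k (Suc l)"
    and nonneg: "\<And>k l. b k l \<ge> 0" and one: "b 0 0 = 1"
  shows "(\<lambda>N. \<Sum>j\<le>N. real (N choose j) * b j (N - j) * (real j / real N) ^ d) \<longlonglongrightarrow> b d 0"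
proof (rule LIMSEQ_I)
  fix e :: real assume e: "e > 0"
  let ?p = "\<lambda>N j. real (N choose j) * b j (N - j)"
  have bound: "\<bar>(\<Sum>j\<le>N. ?p N j * (real j / real N) ^ d) - b d 0\<bar> \<le> (1 + b d 0) * (real d)\<^sup>2 / real N"
    if N: "N \<ge> Suc d" for N
  proof -
    let ?F = "\<lambda>j. fact d / real N ^ d * real (j choose d)"
    have F: "(\<Sum>j\<le>N. ?p N j * ?F j) = ?F N * b d 0"
    proof -
      have "(\<Sum>j\<le>N. ?p N j * ?F j) = fact d / real N ^ d * (\<Sum>j\<le>N. ?p N j * real (j choose d))"
        by (simp add: sum_distrib_left algebra_simps)
      then show ?thesis
        using N pascal_array_factorial_moment[where b = b, OF pascal, of d N] by simp
    qed
    have abs_diff: "\<bar>a * x - a * y\<bar> = a * \<bar>x - y\<bar>" if "a \<ge> 0" for a x y :: real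
      using that by (simp add: abs_mult flip: right_diff_distrib)
    have "(\<Sum>j\<le>N. ?p N j) = 1"
      using pascal_array_sum[where b = b, OF pascal, where N = N and p = 0 and q = 0] one by simp
    have "\<bar>(\<Sum>j\<le>N. ?p N j * (real j / real N) ^ d) - (\<Sum>j\<le>N. ?p N j * ?F j)\<bar>
        \<le> (\<Sum>j\<le>N. \<bar>?p N j * (real j / real N) ^ d - ?p N j * ?F j\<bar>)"
      by (simp flip: sum_subtractf)
    also have "\<dots> \<le> (\<Sum>j\<le>N. ?p N j * ((real d)\<^sup>2 / real N))"
    proof (rule sum_mono)
      fix j assume "j \<in> {..N}"
      then have "\<bar>(real j / real N) ^ d - ?F j\<bar> \<le> (real d)\<^sup>2 / real N"
        using N by (intro power_minus_falling_factorial_le) auto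
      then have "?p N j * \<bar>(real j / real N) ^ d - ?F j\<bar> \<le> ?p N j * ((real d)\<^sup>2 / real N)"
        by (intro mult_left_mono) (auto simp: nonneg)
      then show "\<bar>?p N j * (real j / real N) ^ d - ?p N j * ?F j\<bar> \<le> ?p N j * ((real d)\<^sup>2 / real N)"
        by (subst abs_diff) (simp_all add: nonneg)
    qed
    also have "\<dots> = (real d)\<^sup>2 / real N"
      by (simp only: sum_distrib_right[symmetric] \<open>(\<Sum>j\<le>N. ?p N j) = 1\<close> mult_1)
    finally have 1: "\<bar>(\<Sum>j\<le>N. ?p N j * (real j / real N) ^ d) - ?F N * b d 0\<bar> \<le> (real d)\<^sup>2 / real N"
      unfolding F .
    have "\<bar>1 - ?F N\<bar> \<le> (real d)\<^sup>2 / real N"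
      using power_minus_falling_factorial_le[of N N d] N by simp
    then have "b d 0 * \<bar>1 - ?F N\<bar> \<le> b d 0 * ((real d)\<^sup>2 / real N)"
      by (intro mult_left_mono) (auto simp: nonneg)
    then have 2: "\<bar>b d 0 - ?F N * b d 0\<bar> \<le> b d 0 * ((real d)\<^sup>2 / real N)"
      using abs_diff[OF nonneg, of d 0 1 "?F N"] by (simp add: mult.commute)
    have split: "(1 + b d 0) * (real d)\<^sup>2 / real N = (real d)\<^sup>2 / real N + b d 0 * ((real d)\<^sup>2 / real N)"
      by (simp add: distrib_right add_divide_distrib)
    have triangle: "\<bar>x - z\<bar> \<le> \<bar>x - y\<bar> + \<bar>z - y\<bar>" for x y z :: real
      by linarith
    show ?thesis
      unfolding split by (rule order_trans[OF triangle add_mono[OF 1 2]])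
  qed
  have "(\<lambda>N. (1 + b d 0) * (real d)\<^sup>2 / real N) \<longlonglongrightarrow> 0"
    by (rule lim_const_over_n)
  from LIMSEQ_D[OF this e] obtain N0 where
    N0: "\<And>N. N \<ge> N0 \<Longrightarrow> \<bar>(1 + b d 0) * (real d)\<^sup>2 / real N\<bar> < e"
    by auto
  show "\<exists>N0. \<forall>N\<ge>N0. norm ((\<Sum>j\<le>N. ?p N j * (real j / real N) ^ d) - b d 0) < e"
  proof (intro exI allI impI)
    fix N assume "N \<ge> max N0 (Suc d)"
    then have "N \<ge> Suc d" "N \<ge> N0" by auto
    then show "norm ((\<Sum>j\<le>N. ?p N j * (real j / real N) ^ d) - b d 0) < e"
      unfolding real_norm_def
      by (rule order_le_less_trans[OF bound order_le_less_trans[OF abs_ge_self N0]])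
  qed
qed

text \<open>
  A doubly indexed form of complete monotonicity: the recursion determines \<open>b\<close> from the numbers \<open>b d 0\<close>.
  Place the weights \<open>(N choose j) b j (N - j)\<close> at the points \<open>j / N\<close>. The moments of these measures
  converge to \<open>b d 0\<close>, and as all of them live on \<open>[0, 1]\<close>, Helly's theorem yields a limit along a
  subsequence.
\<close>

theorem hausdorff_moment_problem:
  fixes b :: "nat \<Rightarrow> nat \<Rightarrow> real"
  assumes pascal: "\<And>k l. b k l = b (Suc k) l + b k (Suc l)"
    and nonneg: "\<And>k l. b k l \<ge> 0" and one: "b 0 0 = 1"
  obtains M where "real_distribution M" "AE x in M. 0 \<le> x \<and> x \<le> 1"
    "\<And>d. (\<integral>x. x ^ d \<partial>M) = b d 0"
proof -
  define p where "p N j = real (N choose j) * b j (N - j)" for N j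
  define P where "P N = point_measure {..N} (\<lambda>j. ennreal (p N j))" for N
  define \<nu> where "\<nu> N = distr (P N) borel (\<lambda>j. real j / real N)" for N
  have p: "p N j \<ge> 0" "(\<Sum>j\<le>N. p N j) = 1" for N j
    using pascal_array_sum[where b = b, OF pascal, where N = N and p = 0 and q = 0] one by (auto simp: p_def nonneg)
  have P: "prob_space (P N)" for N
    unfolding P_def by (rule prob_space_point_measure) (auto simp: p)
  have meas [measurable]: "f \<in> measurable (P N) borel" for f :: "nat \<Rightarrow> real" and N
    by (simp add: P_def)
  have \<nu>: "real_distribution (\<nu> N)" for N
    unfolding \<nu>_def by (rule prob_space.real_distribution_distr[OF P]) simp
  interpret \<nu>: real_distribution "\<nu> N" for N by (rule \<nu>)
  have int: "(\<integral>x. f x \<partial>\<nu> N) = (\<Sum>j\<le>N. p N j * f (real j / real N))"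
    if "f \<in> borel_measurable borel" for f :: "real \<Rightarrow> real" and N
    unfolding \<nu>_def using that
    by (subst integral_distr) (auto simp: P_def lebesgue_integral_point_measure_finite p)
  have AE: "AE x in \<nu> N. 0 \<le> x \<and> x \<le> 1" for N
  proof -
    have "AE j in P N. 0 \<le> real j / real N \<and> real j / real N \<le> 1"
      unfolding P_def by (simp add: AE_point_measure divide_simps)
    then show ?thesis
      unfolding \<nu>_def by (subst AE_distr_iff) simp_all
  qed
  have "tight \<nu>"
    unfolding tight_def
  proof (intro conjI allI impI \<nu>)
    fix e :: real assume "e > 0"
    have "measure (\<nu> N) {-1<..1} = 1" for N
      by (rule \<nu>.prob_eq_1[THEN iffD2]) (use AE[of N] in \<open>simp_all, eventually_elim, auto\<close>)
    with \<open>e > 0\<close> show "\<exists>a b. a < b \<and> (\<forall>N. 1 - e < measure (\<nu> N) {a<..b})"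
      by (intro exI[of _ "-1"] exI[of _ "1"]) simp
  qed
  from tight_imp_convergent_subsubsequence[OF this strict_mono_id] obtain r M where
    r: "strict_mono r" and M: "real_distribution M" and conv: "weak_conv_m (\<nu> \<circ> r) M"
    by (auto simp: o_def)
  interpret M: real_distribution M by (rule M)
  have lim: "(\<lambda>n. \<integral>x. f x \<partial>\<nu> (r n)) \<longlonglongrightarrow> (\<integral>x. f x \<partial>M)"
    if "continuous_on UNIV f" "\<And>x. norm (f x) \<le> 1" for f :: "real \<Rightarrow> real"
    using weak_conv_imp_integral_bdd_continuous_conv[OF _ M conv, of f 1] that \<nu>
    by (simp add: continuous_on_eq_continuous_at o_def)
  \<comment> \<open>Weak convergence applies to bounded functions only; on \<open>[0, 1]\<close> clamping changes nothing.\<close>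
  define clamp where "clamp x = max 0 (min 1 x)" for x :: real
  have clamp [measurable]: "clamp \<in> borel_measurable borel" "continuous_on UNIV clamp"
    unfolding clamp_def by (auto intro!: continuous_intros)
  have AE_M: "AE x in M. 0 \<le> x \<and> x \<le> 1"
  proof -
    \<comment> \<open>A bounded continuous function whose zero set is \<open>[0, 1]\<close>.\<close>
    define f where "f x = min 1 \<bar>x - clamp x\<bar>" for x
    have f: "continuous_on UNIV f" "f \<in> borel_measurable borel" "\<And>x. f x \<ge> 0" "\<And>x. norm (f x) \<le> 1"
      unfolding f_def by (auto intro!: continuous_intros clamp)
    have "(\<integral>x. f x \<partial>\<nu> N) = 0" for N
      unfolding int[OF f(2)]
      by (intro sum.neutral ballI) (auto simp: f_def clamp_def divide_simps)
    then have "(\<integral>x. f x \<partial>M) = 0"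
      using lim[OF f(1,4)] by (simp add: LIMSEQ_const_iff)
    moreover have "integrable M f"
      using f by (intro M.integrable_const_bound[of _ 1]) auto
    ultimately have "AE x in M. f x = 0"
      using f by (subst (asm) integral_nonneg_eq_0_iff_AE) auto
    then show ?thesis
      by eventually_elim (auto simp: f_def clamp_def min_def max_def split: if_splits)
  qed
  have "(\<integral>x. x ^ d \<partial>M) = b d 0" for d
  proof -
    define f where "f x = clamp x ^ d" for x
    have f: "continuous_on UNIV f" "f \<in> borel_measurable borel" "\<And>x. norm (f x) \<le> 1"
      unfolding f_def by (auto intro!: continuous_intros clamp power_le_one simp: clamp_def)
    have "(\<integral>x. f x \<partial>\<nu> N) = (\<Sum>j\<le>N. real (N choose j) * b j (N - j) * (real j / real N) ^ d)" for N
      unfolding int[OF f(2)] p_def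
      by (intro sum.cong refl arg_cong2[where f = "(*)"]) (auto simp: f_def clamp_def divide_simps min_def max_def)
    then have "(\<lambda>N. \<integral>x. f x \<partial>\<nu> N) \<longlonglongrightarrow> b d 0"
      using pascal_array_moment[where b = b, OF assms] by simp
    from LIMSEQ_subseq_LIMSEQ[OF this r] have "(\<lambda>n. \<integral>x. f x \<partial>\<nu> (r n)) \<longlonglongrightarrow> b d 0"
      by (simp add: o_def)
    with lim[OF f(1,3)] have "(\<integral>x. f x \<partial>M) = b d 0"
      by (rule LIMSEQ_unique)
    moreover have "(\<integral>x. f x \<partial>M) = (\<integral>x. x ^ d \<partial>M)"
    proof (rule integral_cong_AE)
      show "AE x in M. f x = x ^ d"
        using AE_M by eventually_elim (simp add: f_def clamp_def)
    qed (use f(2) in simp_all)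
    ultimately show ?thesis by simp
  qed
  with M AE_M show ?thesis by (rule that)
qed

section \<open>The group algebra and its trace\<close>

text \<open>
  Reduces linear identities in the group algebra to group elements.
\<close>

lemma group_algebra_induct [case_names zero single add]:
  assumes "P 0" "\<And>g c. P (Poly_Mapping.single g c)" "\<And>a b. P a \<Longrightarrow> P b \<Longrightarrow> P (a + b)"
  shows "P (a :: 'g group_algebra)"
proof (induction a rule: update_induct)
  case (update a g c)
  then have "Poly_Mapping.update g c a = a + Poly_Mapping.single g c"
    by (intro poly_mapping_eqI)
       (auto simp: Poly_Mapping.update.rep_eq lookup_add lookup_single when_def in_keys_iff)
  then show ?case using update assms by simp
qed (rule assms(1))

lemma lookup_convolution:
  fixes a b :: "'g::group_add group_algebra"
  shows "Poly_Mapping.lookup (a * b) g =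
    Sum_any (\<lambda>h. Poly_Mapping.lookup a h * Poly_Mapping.lookup b (- h + g))"
proof -
  have "Sum_any (\<lambda>q. Poly_Mapping.lookup b q when g = h + q) = Poly_Mapping.lookup b (- h + g)" for h
  proof -
    have "g = h + q \<longleftrightarrow> q = - h + g" for q
      by (metis add.assoc add_minus_cancel minus_add_cancel)
    then show ?thesis by simp
  qed
  then show ?thesis by (simp add: lookup_mult)
qed

lemma lookup_algebra_scale: "Poly_Mapping.lookup (algebra_scale c a) g = c * Poly_Mapping.lookup a g"
  by (simp add: algebra_scale_def Poly_Mapping.map.rep_eq when_def)

lemma algebra_scale_add [simp]: "algebra_scale c (a + b) = algebra_scale c a + algebra_scale c b"
  by (intro poly_mapping_eqI) (simp add: lookup_algebra_scale lookup_add distrib_left)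

lemma algebra_scale_single [simp]:
  "algebra_scale c (Poly_Mapping.single g d) = Poly_Mapping.single g (c * d)"
  by (simp add: algebra_scale_def)

lemma algebra_scale_zero [simp]: "algebra_scale c 0 = 0"
  using algebra_scale_single[of c _ 0] by simp

lemma algebra_scale_mult_left: "algebra_scale c a * b = algebra_scale c (a * b)"
proof (induction a rule: group_algebra_induct)
  case (single g d)
  show ?case
    by (induction b rule: group_algebra_induct) (simp_all add: mult_single algebra_simps)
qed (simp_all add: algebra_simps)

lemma algebra_scale_mult_right: "a * algebra_scale c b = algebra_scale c (a * b)"
proof (induction a rule: group_algebra_induct)
  case (single g d)
  show ?case
    by (induction b rule: group_algebra_induct) (simp_all add: mult_single algebra_simps)
qed (simp_all add: algebra_simps)

lemma algebra_scale_scale: "algebra_scale c (algebra_scale d a) = algebra_scale (c * d) a"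
  by (induction a rule: group_algebra_induct) (simp_all add: algebra_simps)

lemma algebra_scale_one [simp]: "algebra_scale 1 a = a"
  by (induction a rule: group_algebra_induct) simp_all

lemma algebra_scale_power: "algebra_scale c a ^ n = algebra_scale (c ^ n) (a ^ n)"
  by (induction n)
     (simp_all add: algebra_scale_mult_left algebra_scale_mult_right algebra_scale_scale mult.commute)

lemma algebra_scale_uminus: "algebra_scale c (- a) = - algebra_scale c (a :: 'g group_algebra)"
  using algebra_scale_add[of c a "- a"] by (simp add: eq_neg_iff_add_eq_0 add.commute)

lemma algebra_scale_diff: "algebra_scale c (a - b) = algebra_scale c a - algebra_scale c (b :: 'g group_algebra)"
  using algebra_scale_add[of c a "- b"] by (simp add: algebra_scale_uminus)

lemma algebra_scale_sum: "algebra_scale c (\<Sum>x\<in>A. f x) = (\<Sum>x\<in>A. algebra_scale c (f x))"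
  by (induction A rule: infinite_finite_induct) simp_all

lemma algebra_scale_left_add: "algebra_scale (c + d) a = algebra_scale c a + algebra_scale d a"
  by (induction a rule: group_algebra_induct) (simp_all add: algebra_simps single_add)

lemma star_add [simp]: "star (a + b) = star a + star b"
  by (intro poly_mapping_eqI) (simp add: star.rep_eq lookup_add)

lemma star_single [simp]: "star (Poly_Mapping.single g c) = Poly_Mapping.single (- g) (cnj c)"
proof (rule poly_mapping_eqI)
  fix h :: 'a
  have "g = - h \<longleftrightarrow> - g = h" by (metis minus_minus)
  then show "Poly_Mapping.lookup (star (Poly_Mapping.single g c)) h =
      Poly_Mapping.lookup (Poly_Mapping.single (- g) (cnj c)) h"
    by (simp add: star.rep_eq lookup_single when_def)
qed

lemma star_zero [simp]: "star 0 = 0"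
  using star_single[of _ 0] by simp

lemma star_one [simp]: "star 1 = 1"
  using star_single[of 0 1] by simp

lemma star_star [simp]: "star (star a) = a"
  by (induction a rule: group_algebra_induct) simp_all

lemma star_mult: "star (a * b) = star b * star a"
proof (induction a rule: group_algebra_induct)
  case (single g d)
  show ?case
    by (induction b rule: group_algebra_induct)
       (simp_all add: mult_single algebra_simps minus_add)
qed (simp_all add: algebra_simps)

lemma star_uminus: "star (- a) = - star a"
  using star_add[of a "- a"] by (simp add: eq_neg_iff_add_eq_0 add.commute)

lemma star_diff: "star (a - b) = star a - star b"
  using star_add[of a "- b"] by (simp add: star_uminus)

lemma star_scale: "star (algebra_scale c a) = algebra_scale (cnj c) (star a)"
  by (induction a rule: group_algebra_induct) simp_all

lemma star_sum_list: "star (\<Sum>x\<leftarrow>xs. f x) = (\<Sum>x\<leftarrow>xs. star (f x))"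
  by (induction xs) simp_all

lemma star_power: "star (a ^ n) = star a ^ n"
  by (induction n) (simp_all add: star_mult power_commutes)

lemma canonical_trace_zero [simp]: "canonical_trace 0 = 0"
  by (simp add: canonical_trace_def)

lemma canonical_trace_one [simp]: "canonical_trace 1 = 1"
  using canonical_trace_group_elem[of 0] by simp

lemma canonical_trace_sum: "canonical_trace (\<Sum>x\<in>A. f x) = (\<Sum>x\<in>A. canonical_trace (f x))"
  by (simp add: canonical_trace_def lookup_sum)

lemma canonical_trace_diff: "canonical_trace (a - b) = canonical_trace a - canonical_trace b"
  by (simp add: canonical_trace_def lookup_minus)

text \<open>
  The trace of \<open>a\<^sup>* a\<close> is the sum of the squares of the absolute values of the coefficients of \<open>a\<close>.
\<close>

lemma canonical_trace_star_mult_self: "canonical_trace (star a * a) \<in> \<real>\<^sub>\<ge>\<^sub>0"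
proof -
  have "canonical_trace (star a * a) = Sum_any (\<lambda>h. of_real ((cmod (Poly_Mapping.lookup a (- h)))\<^sup>2))"
    unfolding canonical_trace_def lookup_convolution
    by (simp add: star.rep_eq complex_norm_square mult.commute del: of_real_power)
  also have "\<dots> \<in> \<real>\<^sub>\<ge>\<^sub>0"
    unfolding Sum_any.expand_set of_real_sum[symmetric] nonneg_Reals_of_real_iff
    by (rule sum_nonneg) simp
  finally show ?thesis .
qed

section \<open>Existence of the law\<close>

definition sum_of_hermitian_squares :: "'g::group_add group_algebra \<Rightarrow> bool" where
  "sum_of_hermitian_squares a \<longleftrightarrow> (\<exists>xs. a = (\<Sum>x\<leftarrow>xs. star x * x))"

lemma star_sum_of_hermitian_squares: "sum_of_hermitian_squares a \<Longrightarrow> star a = a"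
  by (auto simp: sum_of_hermitian_squares_def star_sum_list star_mult)

lemma canonical_trace_sandwich:
  assumes "sum_of_hermitian_squares a"
  shows "canonical_trace (star q * a * q) \<in> \<real>\<^sub>\<ge>\<^sub>0"
proof -
  obtain xs where "a = (\<Sum>x\<leftarrow>xs. star x * x)"
    using assms by (auto simp: sum_of_hermitian_squares_def)
  moreover have "canonical_trace (star q * (\<Sum>x\<leftarrow>xs. star x * x) * q) \<in> \<real>\<^sub>\<ge>\<^sub>0"
  proof (induction xs)
    case (Cons x xs)
    have "star q * (star x * x) * q = star (x * q) * (x * q)"
      by (simp add: star_mult mult.assoc)
    then show ?case
      using Cons canonical_trace_star_mult_self[of "x * q"]
      by (simp add: distrib_left distrib_right canonical_trace_add nonneg_Reals_add_I)
  qed simp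
  ultimately show ?thesis by simp
qed

lemma commute_of_sum_eq_one:
  fixes T U :: "'a::ring_1"
  assumes "T + U = 1"
  shows "T * U = U * T"
proof -
  have "U = 1 - T" using assms by (simp add: eq_diff_eq add.commute)
  then show ?thesis
    by (simp only: right_diff_distrib left_diff_distrib mult_1_left mult_1_right)
qed

lemma power_mult_power_pascal:
  fixes T U :: "'a::ring_1"
  assumes "T + U = 1"
  shows "T ^ k * U ^ l = T ^ Suc k * U ^ l + T ^ k * U ^ Suc l"
proof -
  have "T ^ k * U ^ l = T ^ k * (T + U) * U ^ l" by (simp add: assms)
  then show ?thesis by (simp add: distrib_left distrib_right mult.assoc power_commutes)
qed

text \<open>
  \<open>T\<close> and \<open>U\<close> commute, so \<open>T\<^sup>k U\<^sup>l\<close> has one of the forms \<open>q\<^sup>* q\<close>, \<open>q\<^sup>* T q\<close>, \<open>q\<^sup>* U q\<close> unless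
  both exponents are odd. In that case \<open>T + U = 1\<close> splits it into two terms with one even exponent
  each.
\<close>

lemma canonical_trace_power_mult_power_nonneg:
  assumes TU: "T + U = 1" and T: "sum_of_hermitian_squares T" and U: "sum_of_hermitian_squares U"
  shows "canonical_trace (T ^ k * U ^ l) \<in> \<real>\<^sub>\<ge>\<^sub>0"
proof -
  have comm: "T * U = U * T"
    by (rule commute_of_sum_eq_one[OF TU])
  have comm': "T ^ i * U ^ j = U ^ j * T ^ i" for i j
    by (metis comm power_commuting_commutes)
  have merge: "T ^ i * U ^ j * (T ^ i' * U ^ j') = T ^ (i + i') * U ^ (j + j')" for i j i' j'
  proof -
    have "T ^ i * U ^ j * (T ^ i' * U ^ j') = T ^ i * (U ^ j * T ^ i') * U ^ j'"
      by (simp only: mult.assoc)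
    also have "\<dots> = T ^ i * (T ^ i' * U ^ j) * U ^ j'"
      by (simp only: comm')
    finally show ?thesis by (simp only: mult.assoc power_add)
  qed
  have self: "star (T ^ i * U ^ j) = T ^ i * U ^ j" for i j
    by (simp add: star_mult star_power star_sum_of_hermitian_squares T U comm')
  have ee: "canonical_trace (T ^ (2 * i) * U ^ (2 * j)) \<in> \<real>\<^sub>\<ge>\<^sub>0" for i j
  proof -
    have "T ^ (2 * i) * U ^ (2 * j) = star (T ^ i * U ^ j) * (T ^ i * U ^ j)"
      unfolding self merge mult_2 ..
    then show ?thesis by (simp only: canonical_trace_star_mult_self)
  qed
  have oe: "canonical_trace (T ^ Suc (2 * i) * U ^ (2 * j)) \<in> \<real>\<^sub>\<ge>\<^sub>0" for i j
  proof -
    have "T ^ Suc (2 * i) * U ^ (2 * j) = star (T ^ i * U ^ j) * T * (T ^ i * U ^ j)"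
      unfolding self using merge[of i j 1 0] merge[of "Suc i" j i j] by (simp add: mult_2)
    then show ?thesis using canonical_trace_sandwich[OF T] by simp
  qed
  have eo: "canonical_trace (T ^ (2 * i) * U ^ Suc (2 * j)) \<in> \<real>\<^sub>\<ge>\<^sub>0" for i j
  proof -
    have "T ^ (2 * i) * U ^ Suc (2 * j) = star (T ^ i * U ^ j) * U * (T ^ i * U ^ j)"
      unfolding self using merge[of i j 0 1] merge[of i "Suc j" i j] by (simp add: mult_2)
    then show ?thesis using canonical_trace_sandwich[OF U] by simp
  qed
  consider i j where "k = 2 * i" "l = 2 * j" | i j where "k = Suc (2 * i)" "l = 2 * j"
    | i j where "k = 2 * i" "l = Suc (2 * j)" | i j where "k = Suc (2 * i)" "l = Suc (2 * j)"
    by (metis oddE evenE Suc_eq_plus1)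
  then show ?thesis
  proof cases
    case 1
    then show ?thesis by (simp only: ee)
  next
    case 2
    then show ?thesis by (simp only: oe)
  next
    case 3
    then show ?thesis by (simp only: eo)
  next
    case 4
    have "Suc (Suc (2 * i)) = 2 * Suc i" "Suc (Suc (2 * j)) = 2 * Suc j" by simp_all
    then show ?thesis
      unfolding 4 power_mult_power_pascal[OF TU, of "Suc (2 * i)" "Suc (2 * j)"] canonical_trace_add
      by (simp only: eo oe nonneg_Reals_add_I)
  qed
qed

text \<open>
  The numbers \<open>\<phi> (T\<^sup>k U\<^sup>l)\<close> satisfy the hypotheses of \<open>hausdorff_moment_problem\<close>, which yields a law
  \<open>M\<close> of \<open>T\<close>. Under \<open>M\<close> the polynomials \<open>x\<close> and \<open>1 - x\<close> correspond to \<open>T\<close> and \<open>U\<close>, so the image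
  of \<open>M\<close> under \<open>x \<mapsto> R (2 x - 1)\<close> is a law of \<open>R (T - U)\<close>.
\<close>

lemma ex_is_law:
  fixes T U :: "'g::group_add group_algebra"
  assumes TU: "T + U = 1" and T: "sum_of_hermitian_squares T" and U: "sum_of_hermitian_squares U"
    and s: "s = algebra_scale (of_real R) (T - U)"
  shows "\<exists>M. is_law s M"
proof -
  define b where "b k l = Re (canonical_trace (T ^ k * U ^ l))" for k l
  have b: "canonical_trace (T ^ k * U ^ l) = of_real (b k l)" "b k l \<ge> 0" for k l
    using canonical_trace_power_mult_power_nonneg[OF TU T U, of k l]
    by (auto simp: b_def elim!: nonneg_Reals_cases)
  have pascal: "b k l = b (Suc k) l + b k (Suc l)" for k l
    unfolding b_def by (subst power_mult_power_pascal[OF TU]) (simp only: canonical_trace_add plus_complex.sel)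
  have one: "b 0 0 = 1"
    by (simp add: b_def)
  obtain M where M: "real_distribution M" and AE: "AE x in M. 0 \<le> x \<and> x \<le> 1"
    and mom: "\<And>d. (\<integral>x. x ^ d \<partial>M) = b d 0"
    using hausdorff_moment_problem[of b, OF pascal b(2) one] by blast
  interpret real_distribution M by (rule M)
  \<comment> \<open>Mixed powers make the induction on \<open>d\<close> possible: one factor \<open>2 x - 1 = x - (1 - x)\<close> shifts \<open>k\<close> or \<open>l\<close>.\<close>
  define h where "h d k l x = (2 * x - 1) ^ d * (x ^ k * (1 - x) ^ l)" for d k l and x :: real
  have [measurable]: "h d k l \<in> borel_measurable borel" for d k l
    unfolding h_def by measurable
  have int: "integrable M (h d k l)" for d k l
  proof (rule integrable_const_bound)
    show "AE x in M. norm (h d k l x) \<le> 1"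
      using AE
    proof eventually_elim
      case (elim x)
      then have "\<bar>2 * x - 1\<bar> \<le> 1" by auto
      with elim have "\<bar>2 * x - 1\<bar> ^ d \<le> 1" "x ^ k \<le> 1" "(1 - x) ^ l \<le> 1"
        by (auto intro: power_le_one)
      with elim show ?case
        by (auto simp: h_def abs_mult power_abs intro!: mult_le_one)
    qed
  qed simp
  have h0: "expectation (h 0 k l) = b k l" for k l
  proof (induction l arbitrary: k)
    case 0
    then show ?case by (simp add: h_def mom)
  next
    case (Suc l)
    have "h 0 k (Suc l) = (\<lambda>x. h 0 k l x - h 0 (Suc k) l x)"
      by (auto simp: h_def algebra_simps)
    then show ?case
      using Suc[of k] Suc[of "Suc k"] pascal[of k l] int by simp
  qed
  have hd: "of_real (expectation (h d k l)) = canonical_trace ((T - U) ^ d * (T ^ k * U ^ l))" for d k l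
  proof (induction d arbitrary: k l)
    case 0
    show ?case by (simp add: h0 b)
  next
    case (Suc d)
    have comm: "T * U = U * T"
      by (rule commute_of_sum_eq_one[OF TU])
    have "U * T ^ k = T ^ k * U"
      by (rule power_commuting_commutes[symmetric]) (rule comm)
    then have "(T - U) * (T ^ k * U ^ l) = T ^ Suc k * U ^ l - T ^ k * U ^ Suc l"
      by (simp add: left_diff_distrib mult.assoc[symmetric])
    moreover have "(T - U) ^ Suc d * (T ^ k * U ^ l) = (T - U) ^ d * ((T - U) * (T ^ k * U ^ l))"
      by (simp only: power_Suc2 mult.assoc)
    ultimately have 1: "(T - U) ^ Suc d * (T ^ k * U ^ l) =
        (T - U) ^ d * (T ^ Suc k * U ^ l) - (T - U) ^ d * (T ^ k * U ^ Suc l)"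
      by (simp only: right_diff_distrib)
    have "h (Suc d) k l = (\<lambda>x. h d (Suc k) l x - h d k (Suc l) x)"
      by (auto simp: h_def algebra_simps)
    then have "expectation (h (Suc d) k l) = expectation (h d (Suc k) l) - expectation (h d k (Suc l))"
      using int by simp
    then show ?case
      unfolding 1 canonical_trace_diff Suc[symmetric] by simp
  qed
  define N where "N = distr M borel (\<lambda>x. R * (2 * x - 1))"
  have "is_law s N"
    unfolding is_law_def
  proof (intro conjI exI allI impI)
    show "prob_space N"
      unfolding N_def by (rule prob_space_distr) simp
    then interpret N: prob_space N .
    show "sets N = sets borel" by (simp add: N_def)
    show "compact (cball 0 \<bar>R\<bar> :: real set)" by simp
    have "AE x in N. x \<in> cball 0 \<bar>R\<bar>"
      unfolding N_def
    proof (subst AE_distr_iff)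
      show "AE x in M. R * (2 * x - 1) \<in> cball 0 \<bar>R\<bar>"
        using AE
      proof eventually_elim
        case (elim x)
        then have "\<bar>R\<bar> * \<bar>2 * x - 1\<bar> \<le> \<bar>R\<bar> * 1" by (intro mult_left_mono) auto
        then show ?case by (simp add: abs_mult)
      qed
    qed simp_all
    then show "measure N (cball 0 \<bar>R\<bar>) = 1"
      by (subst N.prob_eq_1) (simp_all add: N_def)
  next
    fix d :: nat
    have "(\<integral>x. x ^ d \<partial>N) = (\<integral>x. R ^ d * h d 0 0 x \<partial>M)"
      unfolding N_def by (subst integral_distr) (simp_all add: h_def power_mult_distrib)
    also have "\<dots> = R ^ d * expectation (h d 0 0)" by simp
    finally show "complex_of_real (\<integral>x. x ^ d \<partial>N) = canonical_trace (s ^ d)"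
      by (simp add: hd s algebra_scale_power canonical_trace_algebra_scale)
  qed
  then show ?thesis ..
qed

section \<open>The law and the moments of the normalized sums\<close>

lemma sum_of_hermitian_squares_scaled_sum:
  fixes n :: nat
  assumes "c \<ge> 0"
  shows "sum_of_hermitian_squares (algebra_scale (of_real c) (\<Sum>i<n. star (f i) * f i))"
  unfolding sum_of_hermitian_squares_def
proof (intro exI)
  have "complex_of_real (sqrt c) * complex_of_real (sqrt c) = of_real c"
    using assms by (simp flip: of_real_mult)
  then have "algebra_scale (of_real c) (star (f i) * f i) =
      star (algebra_scale (of_real (sqrt c)) (f i)) * algebra_scale (of_real (sqrt c)) (f i)" for i
    by (simp add: star_scale algebra_scale_mult_left algebra_scale_mult_right algebra_scale_scale)
  then show "algebra_scale (of_real c) (\<Sum>i<n. star (f i) * f i) =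
      (\<Sum>x\<leftarrow>map (\<lambda>i. algebra_scale (of_real (sqrt c)) (f i)) [0..<n]. star x * x)"
    by (simp add: algebra_scale_sum interv_sum_list_conv_sum_set_nat atLeast0LessThan o_def)
qed

lemma thompson_s_eq:
  "thompson_s n = algebra_scale (of_real (1 / sqrt (2 * n)))
     (\<Sum>i<n. group_elem (thompson_gen i) + group_elem (- thompson_gen i))"
proof -
  have "1 / complex_of_real (sqrt n) * (1 / complex_of_real (sqrt 2)) = of_real (1 / sqrt (2 * n))"
    by (simp add: real_sqrt_mult)
  then show ?thesis
    unfolding thompson_s_def thompson_a_def star_group_elem algebra_scale_sum[symmetric]
      algebra_scale_scale by simp
qed

text \<open>
  For a unitary \<open>g\<close> one has \<open>(1 \<plusminus> g)\<^sup>* (1 \<plusminus> g) = 2 \<plusminus> (g + g\<^sup>*)\<close>. Averaging these identities over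
  \<open>g\<^sub>0, \<dots>, g\<^sub>n\<^sub>-\<^sub>1\<close>, with an additional factor \<open>1/4\<close>, gives \<open>T\<close> and \<open>U\<close> with \<open>T + U = 1\<close> and \<open>T - U\<close> proportional to \<open>s\<^sub>n\<close>.
\<close>

lemma ex_law_thompson_s:
  assumes n: "n \<ge> 1"
  shows "\<exists>M. is_law (thompson_s n) M"
proof (rule ex_is_law)
  let ?g = "\<lambda>i. group_elem (thompson_gen i)" and ?g' = "\<lambda>i. group_elem (- thompson_gen i)"
  define T where "T = algebra_scale (of_real (1 / (4 * n))) (\<Sum>i<n. star (1 + ?g i) * (1 + ?g i))"
  define U where "U = algebra_scale (of_real (1 / (4 * n))) (\<Sum>i<n. star (1 - ?g i) * (1 - ?g i))"
  show "sum_of_hermitian_squares T" "sum_of_hermitian_squares U"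
    unfolding T_def U_def by (rule sum_of_hermitian_squares_scaled_sum; simp)+
  have gg': "?g' i * ?g i = 1" for i
    by (simp add: mult_single)
  have const: "(\<Sum>i<m. Poly_Mapping.single 0 c) = Poly_Mapping.single (0::thompson) (of_nat m * c)"
    for m and c :: complex
    by (induction m) (simp_all add: algebra_simps flip: single_add)
  have plus: "star (1 + ?g i) * (1 + ?g i) = (1 + 1) + (?g i + ?g' i)" for i
    by (simp add: distrib_left distrib_right gg' algebra_simps)
  have minus: "star (1 - ?g i) * (1 - ?g i) = (1 + 1) - (?g i + ?g' i)" for i
    by (simp add: star_diff left_diff_distrib right_diff_distrib gg' algebra_simps)
  have "T + U = algebra_scale (of_real (1 / (4 * n))) (\<Sum>i<n. 4)"
    unfolding T_def U_def plus minus
    by (simp add: algebra_simps flip: algebra_scale_add sum.distrib)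
  also have "\<dots> = algebra_scale (of_real (1 / (4 * n))) (\<Sum>i<n. Poly_Mapping.single 0 4)"
    by simp
  also have "\<dots> = 1"
    unfolding const using n by simp
  finally show "T + U = 1" .
  have twice: "((1 + 1) + a) - ((1 + 1) - a) = algebra_scale 2 a" for a :: "thompson group_algebra"
    using algebra_scale_left_add[of 1 1 a] by (simp add: algebra_simps)
  have "T - U = algebra_scale (of_real (1 / (4 * n))) (\<Sum>i<n. algebra_scale 2 (?g i + ?g' i))"
    unfolding T_def U_def plus minus algebra_scale_diff[symmetric] sum_subtractf[symmetric] twice ..
  also have "\<dots> = algebra_scale (of_real (1 / (2 * n))) (\<Sum>i<n. ?g i + ?g' i)"
    unfolding algebra_scale_sum[symmetric] algebra_scale_scale by simp
  finally have diff: "T - U = \<dots>" .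
  have "sqrt (2 * n) * (1 / (2 * n)) = 1 / sqrt (2 * n)"
    using real_sqrt_mult_self[of "2 * n"] n by (simp add: field_simps)
  then show "thompson_s n = algebra_scale (of_real (sqrt (2 * n))) (T - U)"
    unfolding diff thompson_s_eq algebra_scale_scale of_real_mult[symmetric] by simp
qed

lemma is_law_law_thompson_s:
  assumes "n \<ge> 1"
  shows "is_law (thompson_s n) (law (thompson_s n))"
  unfolding law_def by (rule theI') (metis ex_law_thompson_s[OF assms] is_law_unique)

lemma power_sum_group_elem:
  assumes "finite A"
  shows "(\<Sum>x\<in>A. group_elem (h x)) ^ d =
    (\<Sum>w | length w = d \<and> set w \<subseteq> A. group_elem (\<Sum>x\<leftarrow>w. h x :: 'g::monoid_add))"
proof (induction d)
  case 0
  have "{w :: 'a list. length w = 0 \<and> set w \<subseteq> A} = {[]}" by auto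
  then show ?case by simp
next
  case (Suc d)
  let ?W = "\<lambda>d. {w. length w = d \<and> set w \<subseteq> A}"
  have "(\<Sum>x\<in>A. group_elem (h x)) ^ Suc d =
      (\<Sum>x\<in>A. \<Sum>w\<in>?W d. group_elem (h x) * group_elem (\<Sum>x\<leftarrow>w. h x))"
    by (simp add: Suc sum_product)
  also have "\<dots> = (\<Sum>(x, w)\<in>A \<times> ?W d. group_elem (\<Sum>x\<leftarrow>x # w. h x))"
    by (simp add: sum.cartesian_product mult_single)
  also have "\<dots> = (\<Sum>w\<in>?W (Suc d). group_elem (\<Sum>x\<leftarrow>w. h x))"
    by (rule sum.reindex_bij_witness[where i = "\<lambda>w. (hd w, tl w)" and j = "\<lambda>(x, w). x # w"])
       (auto simp: length_Suc_conv)
  finally show ?case .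
qed

lemma canonical_trace_thompson_s_power:
  "canonical_trace (thompson_s n ^ d) = of_real (real (card (trivial_words d n)) / sqrt (2 * n) ^ d)"
proof -
  let ?A = "{..<n} \<times> (UNIV :: bool set)"
  let ?W = "{w. length w = d \<and> set w \<subseteq> ?A}"
  have fin: "finite ?W"
    using finite_lists_length_eq[of ?A d] by (simp add: conj_commute)
  have "(\<Sum>i<n. group_elem (thompson_gen i) + group_elem (- thompson_gen i)) =
      (\<Sum>x\<in>?A. group_elem (letter x))"
    by (simp add: sum.cartesian_product' UNIV_bool letter_def add.commute)
  then have "canonical_trace (thompson_s n ^ d) =
      of_real (1 / sqrt (2 * n)) ^ d * (\<Sum>w\<in>?W. canonical_trace (group_elem (word_value w)))"
    by (simp add: thompson_s_eq algebra_scale_power canonical_trace_algebra_scale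
          power_sum_group_elem canonical_trace_sum word_value_def)
  also have "(\<Sum>w\<in>?W. canonical_trace (group_elem (word_value w))) = of_nat (card (trivial_words d n))"
    unfolding canonical_trace_group_elem
    using fin by (subst sum.If_cases) (auto simp: trivial_words_def intro!: arg_cong[where f = card])
  finally show ?thesis
    by (simp add: power_divide)
qed

lemma canonical_trace_thompson_s_power_tendsto:
  "(\<lambda>n. canonical_trace (thompson_s n ^ d)) \<longlonglongrightarrow>
     of_real (\<integral>x. x ^ d \<partial>std_normal_distribution)"
proof (cases "even d")
  case True
  then obtain m where d: "d = 2 * m" by (elim evenE)
  have "sqrt (2 * real n) ^ (2 * m) = (2 * real n) ^ m" for n
    by (simp add: power_mult)
  then show ?thesis
    using trivial_words_even_asymptotics[of m]
    unfolding canonical_trace_thompson_s_power d std_normal_moments by (intro tendsto_of_real) simp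
next
  case False
  then obtain m where d: "d = 2 * m + 1" by (elim oddE)
  show ?thesis
    unfolding canonical_trace_thompson_s_power trivial_words_odd[OF False]
    unfolding d std_normal_moments by simp
qed

theorem corollary5p1:
  fixes \<mu> :: "nat \<Rightarrow> real measure"
  assumes "\<And>n. n \<ge> 1 \<Longrightarrow> \<mu> n = law (thompson_s n)"
  shows "weak_star_limit \<mu> std_normal_distribution"
proof -
  \<comment> \<open>The hypothesis leaves \<open>\<mu> 0\<close> arbitrary.\<close>
  define M where "M n = \<mu> (Suc n)" for n
  have law: "is_law (thompson_s (Suc n)) (M n)" for n
    unfolding M_def using assms[of "Suc n"] is_law_law_thompson_s[of "Suc n"] by simp
  have M: "real_distribution (M n)" for n
    by (rule is_law_real_distribution[OF law])
  have int: "integrable (M n) (\<lambda>x. x ^ k)" for n k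
    using is_law_AE_bounded[OF law] integrable_power_of_AE_bounded[OF M] by metis
  have lim: "(\<lambda>n. \<integral>x. x ^ k \<partial>M n) \<longlonglongrightarrow> (\<integral>x. x ^ k \<partial>std_normal_distribution)" for k
  proof (cases "k = 0")
    case True
    have one: "(\<integral>x. x ^ 0 \<partial>N) = 1" if "real_distribution N" for N :: "real measure"
      using prob_space.prob_space[of N] that by (simp add: real_distribution_def)
    show ?thesis
      unfolding True one[OF M] one[OF real_dist_normal_dist] by (rule tendsto_const)
  next
    case False
    have "complex_of_real (\<integral>x. x ^ k \<partial>M n) = canonical_trace (thompson_s (Suc n) ^ k)" for n
      using law[of n] False by (simp add: is_law_def)
    then have "(\<lambda>n. complex_of_real (\<integral>x. x ^ k \<partial>M n))
        \<longlonglongrightarrow> of_real (\<integral>x. x ^ k \<partial>std_normal_distribution)"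
      using LIMSEQ_Suc[OF canonical_trace_thompson_s_power_tendsto[of k]] by simp
    then show ?thesis by (simp only: tendsto_of_real_iff)
  qed
  have conv: "weak_conv_m M std_normal_distribution"
    by (rule weak_conv_std_normal_of_moments[OF M int lim])
  show ?thesis
    unfolding weak_star_limit_def
  proof (intro allI impI, elim conjE)
    fix f :: "real \<Rightarrow> real" assume f: "continuous_on UNIV f" "bounded (range f)"
    then obtain B where "\<And>x. norm (f x) \<le> B" by (auto simp: bounded_iff)
    then have "(\<lambda>n. \<integral>t. f t \<partial>M n) \<longlonglongrightarrow> (\<integral>t. f t \<partial>std_normal_distribution)"
      using f M real_dist_normal_dist conv
      by (intro weak_conv_imp_integral_bdd_continuous_conv) (simp_all add: continuous_on_eq_continuous_at)
    then show "(\<lambda>n. \<integral>t. f t \<partial>\<mu> n) \<longlonglongrightarrow> (\<integral>t. f t \<partial>std_normal_distribution)"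
      unfolding M_def by (rule LIMSEQ_imp_Suc)
  qed
qed

end
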